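(* Let $0\le p<q$ be integers. Let $\vec a\in(\mathbb Q_{>-1})^p$, $\vec b\in(\mathbb Q_{>-1})^q$ with $a_j<b_j$ for all $1\le j\le p$, and let $z\in\mathbb Q\setminus\{0\}$. Suppose that $a_i-b_j,\ b_i-b_j\notin\mathbb Z_{\ge0}$ whenever $i\ne j$. Then $1$ and the constants $$\sum_{k\ge0}\frac{(\vec a+1)_k}{(\vec b+1)_k\prod_{i=1}^j(b_i+k+1)}\,z^k,\qquad j=1,\dots,q,$$ are $\mathbb Q$-linearly independent. In particular, these constants are irrational.
   Context: $(s)_k=\prod_{i=0}^{k-1}(s+i)$; for a vector $\vec s$, $(\vec s)_k=\prod_j(s_j)_k$ (equal to $1$ for the empty vector), and $\vec s+1$ means adding $1$ to each component. "These constants are irrational" refers to the $q$ series for $j=1,\dots,q$. *)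

theory Defs
  imports "HOL-Analysis.Analysis"
begin

text \<open>
  A vector \<open>(s\<^sub>1, \<dots>, s\<^sub>n)\<close> is given by its length \<open>n\<close> and a function on indices, of which
  only the values at \<open>1, \<dots>, n\<close> are used.
\<close>

definition vec_pochhammer :: "nat \<Rightarrow> (nat \<Rightarrow> 'a::comm_semiring_1) \<Rightarrow> nat \<Rightarrow> 'a" where
  "vec_pochhammer n s k = (\<Prod>i=1..n. pochhammer (s i) k)"

definition hyp_term ::
    "nat \<Rightarrow> nat \<Rightarrow> (nat \<Rightarrow> rat) \<Rightarrow> (nat \<Rightarrow> rat) \<Rightarrow> rat \<Rightarrow> nat \<Rightarrow> nat \<Rightarrow> rat" where
  "hyp_term p q a b z j k =
     vec_pochhammer p (\<lambda>i. a i + 1) k /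
       (vec_pochhammer q (\<lambda>i. b i + 1) k * (\<Prod>i=1..j. b i + of_nat k + 1)) * z ^ k"

definition hyp_const ::
    "nat \<Rightarrow> nat \<Rightarrow> (nat \<Rightarrow> rat) \<Rightarrow> (nat \<Rightarrow> rat) \<Rightarrow> rat \<Rightarrow> nat \<Rightarrow> real" where
  "hyp_const p q a b z j = (\<Sum>k. of_rat (hyp_term p q a b z j k))"

text \<open>
  Linear independence over the rationals of a finite family \<open>(v i)\<^bsub>i \<in> I\<^esub>\<close> of reals: the members
  are pairwise distinct and form a linearly independent set. Distinctness has to be demanded
  separately since \<^const>\<open>module.dependent\<close> speaks about sets and ignores repetitions.
\<close>

definition rat_lin_indep_family :: "'i set \<Rightarrow> ('i \<Rightarrow> real) \<Rightarrow> bool" where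
  "rat_lin_indep_family I v \<longleftrightarrow>
     inj_on v I \<and> \<not> module.dependent (\<lambda>c::rat. (*) (of_rat c :: real)) (v ` I)"

lemma vector_space_rat_real: "vector_space (\<lambda>c::rat. (*) (of_rat c :: real))"
  by unfold_locales (simp_all add: algebra_simps of_rat_add of_rat_mult)

lemma rat_lin_indep_family_iff:
  assumes "finite I"
  shows "rat_lin_indep_family I v \<longleftrightarrow>
    (\<forall>c::'i \<Rightarrow> rat. (\<Sum>i\<in>I. of_rat (c i) * v i) = 0 \<longrightarrow> (\<forall>i\<in>I. c i = 0))"
proof -
  interpret Q: vector_space "\<lambda>c::rat. (*) (of_rat c :: real)"
    by (rule vector_space_rat_real)
  show ?thesis
  proof (intro iffI allI impI ballI)
    fix c :: "'i \<Rightarrow> rat" and i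
    assume indep: "rat_lin_indep_family I v" and s: "(\<Sum>i\<in>I. of_rat (c i) * v i) = 0" and i: "i \<in> I"
    have inj: "inj_on v I" using indep by (simp add: rat_lin_indep_family_def)
    let ?u = "\<lambda>x. c (the_inv_into I v x)"
    have "(\<Sum>x\<in>v ` I. of_rat (?u x) * x) = (\<Sum>i\<in>I. of_rat (c i) * v i)"
      by (subst sum.reindex[OF inj]) (simp add: the_inv_into_f_f[OF inj])
    with s have "(\<Sum>x\<in>v ` I. of_rat (?u x) * x) = 0" by simp
    moreover have "Q.independent (v ` I)" using indep by (simp add: rat_lin_indep_family_def)
    ultimately have "?u (v i) = 0"
      using Q.independentD[of "v ` I" "v ` I" ?u "v i"] assms i by auto
    then show "c i = 0" using the_inv_into_f_f[OF inj i] by simp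
  next
    assume R: "\<forall>c::'i \<Rightarrow> rat. (\<Sum>i\<in>I. of_rat (c i) * v i) = 0 \<longrightarrow> (\<forall>i\<in>I. c i = 0)"
    have inj: "inj_on v I"
    proof (rule inj_onI, rule ccontr)
      fix x y assume xy: "x \<in> I" "y \<in> I" "v x = v y" "x \<noteq> y"
      let ?c = "\<lambda>i. if i = x then 1 else if i = y then -1 else (0::rat)"
      have "(\<Sum>i\<in>I. of_rat (?c i) * v i) = (\<Sum>i\<in>{x,y}. of_rat (?c i) * v i)"
        using assms xy by (intro sum.mono_neutral_right) auto
      also have "\<dots> = 0" using xy by simp
      finally have "\<forall>i\<in>I. ?c i = 0" using R[rule_format, of ?c] by blast
      then show False using xy(1) by force
    qed
    have "Q.independent (v ` I)"
    proof (rule Q.independent_if_scalars_zero)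
      show "finite (v ` I)" using assms by simp
      fix f :: "real \<Rightarrow> rat" and x
      assume "(\<Sum>x\<in>v ` I. of_rat (f x) * x) = 0" and x: "x \<in> v ` I"
      then have "(\<Sum>i\<in>I. of_rat (f (v i)) * v i) = 0" by (simp add: sum.reindex[OF inj])
      with R[rule_format, of "\<lambda>i. f (v i)"] x show "f x = 0" by auto
    qed
    with inj show "rat_lin_indep_family I v" by (simp add: rat_lin_indep_family_def)
  qed
qed

lemma vec_pochhammer_Suc:
  "vec_pochhammer n s (Suc k) = vec_pochhammer n s k * (\<Prod>i=1..n. s i + of_nat k)"
  by (simp add: vec_pochhammer_def pochhammer_Suc prod.distrib)

lemma summable_hyp_term:
  assumes pq: "p < q" and j: "j \<le> q"
    and a: "\<forall>i\<in>{1..p}. a i > -1" and b: "\<forall>i\<in>{1..q}. b i > -1"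
    and ab: "\<forall>i\<in>{1..p}. a i < b i"
  shows "summable (\<lambda>k. real_of_rat (hyp_term p q a b z j k))"
proof (rule summable_ratio_test)
  show "(1/2::real) < 1" by simp
  define N where "N = max 1 (nat \<lceil>2 * \<bar>z\<bar>\<rceil>)"
  fix k assume k: "N \<le> k"
  have k1: "k \<ge> 1" using k by (simp add: N_def)
  have kz: "2 * \<bar>z\<bar> \<le> of_nat k" using k unfolding N_def by linarith
  let ?A = "\<Prod>i=1..p. a i + 1 + of_nat k" and ?B = "\<Prod>i=1..q. b i + 1 + of_nat k"
  let ?D = "\<lambda>k. \<Prod>i=1..j. b i + of_nat k + 1"
  let ?P = "vec_pochhammer p (\<lambda>i. a i + 1) k" and ?Q = "vec_pochhammer q (\<lambda>i. b i + 1) k"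
  have a0: "0 < a i + 1 + of_nat k" if "i \<in> {1..p}" for i
    using bspec[OF a that] of_nat_0_le_iff[of k, where 'a=rat] by linarith
  have b0: "of_nat k < b i + 1 + of_nat k" if "i \<in> {1..q}" for i
    using bspec[OF b that] by linarith
  have A: "?A > 0" by (intro prod_pos) (use a0 in auto)
  have B: "?B > 0" by (intro prod_pos) (use b0 order.strict_trans1[OF of_nat_0_le_iff] in blast)
  have P: "?P > 0" unfolding vec_pochhammer_def
    by (intro prod_pos ballI pochhammer_pos) (use a in fastforce)
  have Q: "?Q > 0" unfolding vec_pochhammer_def
    by (intro prod_pos ballI pochhammer_pos) (use b in fastforce)
  have D: "?D k > 0"
  proof (intro prod_pos ballI)
    fix i assume "i \<in> {1..j}"
    then show "0 < b i + of_nat k + 1" using b0[of i] j of_nat_0_le_iff[of k, where 'a=rat] by auto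
  qed
  have DD: "?D k \<le> ?D (Suc k)"
  proof (intro prod_mono conjI)
    fix i assume "i \<in> {1..j}"
    then show "0 \<le> b i + of_nat k + 1" using b0[of i] j of_nat_0_le_iff[of k, where 'a=rat] by auto
  qed auto
  have AB: "?A * of_nat k \<le> ?B"
  proof -
    have "{1..q} = {1..p} \<union> {p<..<q} \<union> {q}" using pq by auto
    then have "?B = (\<Prod>i=1..p. b i + 1 + of_nat k) * (\<Prod>i\<in>{p<..<q}. b i + 1 + of_nat k)
        * (b q + 1 + of_nat k)"
    proof -
      have "prod f ({1..p} \<union> {p<..<q} \<union> {q}) = prod f {1..p} * prod f {p<..<q} * f q" for f :: "nat \<Rightarrow> rat"
        using pq by (subst prod.union_disjoint; (subst prod.union_disjoint)?) auto
      then show ?thesis using \<open>{1..q} = _\<close> by presburger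
    qed
    moreover have "?A \<le> (\<Prod>i=1..p. b i + 1 + of_nat k)"
      using a0 ab by (intro prod_mono) (auto intro: less_imp_le)
    moreover have "1 \<le> (\<Prod>i\<in>{p<..<q}. b i + 1 + of_nat k)"
    proof (rule prod_ge_1)
      fix i assume "i \<in> {p<..<q}"
      then have "of_nat k < b i + 1 + of_nat k" using b0[of i] by auto
      moreover have "1 \<le> (of_nat k :: rat)" using k1 by simp
      ultimately show "1 \<le> b i + 1 + of_nat k" by linarith
    qed
    moreover have "of_nat k \<le> b q + 1 + of_nat k" using b0[of q] pq by auto
    ultimately have "?A * 1 * of_nat k \<le> ?B"
      using A by (simp only:) (intro mult_mono, auto)
    then show ?thesis by simp
  qed
  have "\<bar>hyp_term p q a b z j (Suc k)\<bar> = (?P / ?Q) * (?A / ?B) / \<bar>?D (Suc k)\<bar> * \<bar>z\<bar> ^ Suc k"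
    using A B P Q by (simp add: hyp_term_def vec_pochhammer_Suc abs_mult power_abs)
  also have "\<dots> \<le> (?P / ?Q) * (?A / ?B) / ?D k * \<bar>z\<bar> ^ Suc k"
    using A B P Q D DD by (intro mult_right_mono divide_left_mono mult_pos_pos) auto
  also have "\<dots> = (?P / ?Q / ?D k * \<bar>z\<bar> ^ k) * ((?A / ?B) * \<bar>z\<bar>)" by (simp add: mult_ac)
  also have "\<dots> \<le> (?P / ?Q / ?D k * \<bar>z\<bar> ^ k) * (1/2)"
  proof (rule mult_left_mono)
    have "?A * (2 * \<bar>z\<bar>) \<le> ?A * of_nat k" using A kz by (intro mult_left_mono) auto
    then have "?A * (2 * \<bar>z\<bar>) \<le> ?B" using AB by linarith
    then show "(?A / ?B) * \<bar>z\<bar> \<le> 1/2" using B by (simp add: field_simps)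
  qed (use P Q D in auto)
  also have "\<dots> = 1/2 * \<bar>hyp_term p q a b z j k\<bar>"
    using P Q D by (simp add: hyp_term_def abs_mult power_abs)
  finally have "real_of_rat \<bar>hyp_term p q a b z j (Suc k)\<bar>
      \<le> real_of_rat (1/2 * \<bar>hyp_term p q a b z j k\<bar>)"
    by (simp only: of_rat_less_eq)
  then show "norm (real_of_rat (hyp_term p q a b z j (Suc k)))
      \<le> 1/2 * norm (real_of_rat (hyp_term p q a b z j k))"
    by (simp add: of_rat_mult of_rat_divide flip: abs_of_rat)
qed

end

theory Submission
  imports Defs
begin

text \<open>
  Put \<open>A(x) = \<Prod>i\<le>p. (a\<^sub>i + 1 + x)\<close>, \<open>B(x) = \<Prod>i\<le>q. (b\<^sub>i + 1 + x)\<close> and let \<open>c\<^sub>k\<close> be the quotient of Pochhammer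
  symbols. A relation \<open>\<lambda>\<^sub>0 + \<Sum>j. \<lambda>\<^sub>j f\<^sub>j(z) = 0\<close> with rational coefficients reads \<open>\<lambda>\<^sub>0 + \<Sum>k. c\<^sub>k G(k)/B(k) z\<^sup>k = 0\<close> with a
  nonzero polynomial \<open>G\<close> of degree less than \<open>q\<close>. The normalized partial sums \<open>y\<^sub>l\<close> of this series are
  rational and satisfy \<open>z A(l) y\<^sub>l\<^sub>+\<^sub>1 = B(l) y\<^sub>l + G(l)\<close>.

  With \<open>V\<^sub>n(x) = B(x) B(x+1) \<dots> B(x+n-1)\<close>, the \<open>q n\<close>-th differences of \<open>V\<^sub>n y / n!\<^sup>q\<close> at arguments of size \<open>O(n)\<close>
  have a common denominator that is exponential in \<open>n\<close>. Writing \<open>y\<^sub>l\<close> as a tail of the series, the first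
  \<open>n\<close> terms contribute polynomials of degree less than \<open>q n\<close>, which the difference kills, and the others
  add up to \<open>O(C\<^sup>n / n!)\<close>. So for some \<open>n\<close> all these differences vanish, \<open>V\<^sub>n y\<close> agrees with a polynomial of
  degree less than \<open>q n\<close> at so many integers that the recurrence becomes an identity of rational functions,
  and a look at poles and degrees shows that it has no rational solution.
\<close>

section \<open>Denominators of Pochhammer quotients\<close>

lemma prime_dvd_choose_prime_power:
  fixes r :: nat
  assumes "prime r" "0 < i" "i < r ^ e"
  shows "r dvd (r ^ e choose i)"
proof (rule ccontr)
  assume "\<not> r dvd (r ^ e choose i)"
  then have "coprime (r ^ e) (r ^ e choose i)"
    using assms(1) by (simp add: prime_imp_coprime)
  moreover have "r ^ e dvd i * (r ^ e choose i)"
    using assms(2) times_binomial_minus1_eq[of i "r ^ e"] by simp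
  ultimately have "r ^ e dvd i"
    by (simp add: coprime_dvd_mult_left_iff)
  with assms(2,3) show False
    by (simp add: dvd_imp_le leD)
qed

text \<open>Split 2m = r^e + (2m - r^e) in Vandermonde's identity. The terms with 0 < k <= m < r^e
  are divisible by r, and the term k = 0 vanishes because 2m - r^e < m.\<close>

lemma prime_dvd_central_binomial:
  fixes r :: nat
  assumes "prime r" "m < r ^ e" "r ^ e \<le> 2 * m"
  shows "r dvd ((2 * m) choose m)"
proof -
  have "r dvd (\<Sum>k\<le>m. (r ^ e choose k) * ((2 * m - r ^ e) choose (m - k)))"
  proof (rule dvd_sum)
    fix k assume "k \<in> {..m}"
    then show "r dvd (r ^ e choose k) * ((2 * m - r ^ e) choose (m - k))"
      using assms prime_dvd_choose_prime_power[OF assms(1), of k e]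
      by (cases "k = 0") (auto simp: binomial_eq_0)
  qed
  also have "\<dots> = ((2 * m) choose m)"
    using assms(3) by (simp add: vandermonde)
  finally show ?thesis .
qed

lemma Lcm_pos:
  fixes m :: nat
  shows "0 < Lcm {1..m}"
  using Lcm_0_iff[of "{1..m}"] by (simp add: gr0_conv_Suc[symmetric] neq0_conv[symmetric] del: neq0_conv)

text \<open>A prime power \<open>r ^ e\<close> in \<open>(m, 2 m]\<close> costs one factor \<open>r\<close> more than \<open>Lcm {1..m}\<close> provides; the central
  binomial coefficient supplies it.\<close>

lemma Lcm_double_dvd:
  fixes m :: nat
  shows "Lcm {1..2 * m} dvd Lcm {1..m} * ((2 * m) choose m)"
proof (rule Lcm_least)
  fix k assume k: "k \<in> {1..2 * m}"
  let ?L = "Lcm {1..m}"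
  have L0: "?L \<noteq> 0" by (simp add: Lcm_0_iff)
  have C0: "(2 * m) choose m \<noteq> 0" by simp
  show "k dvd ?L * ((2 * m) choose m)"
  proof (rule multiplicity_le_imp_dvd)
    show "k \<noteq> 0" using k by simp
    fix r :: nat assume r: "prime r"
    define e where "e = multiplicity r k"
    have "r ^ e dvd k" unfolding e_def by (rule multiplicity_dvd)
    then have le: "r ^ e \<le> 2 * m" using k by (auto dest!: dvd_imp_le)
    have "r ^ e dvd ?L * ((2 * m) choose m)"
    proof (cases "r ^ e \<le> m")
      case True
      then have "r ^ e \<in> {1..m}" using r by (simp add: prime_gt_0_nat Suc_leI)
      then show ?thesis by (intro dvd_mult2 dvd_Lcm)
    next
      case False
      show ?thesis
      proof (cases e)
        case (Suc f)
        have "2 * r ^ f \<le> r ^ e" using prime_ge_2_nat[OF r] Suc by simp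
        then have "r ^ f \<in> {1..m}" using le r by (simp add: prime_gt_0_nat Suc_leI)
        then have "r ^ f dvd ?L" by (rule dvd_Lcm)
        moreover have "r dvd ((2 * m) choose m)"
          using False le by (intro prime_dvd_central_binomial[OF r]) auto
        ultimately show ?thesis using Suc by (metis mult_dvd_mono power_Suc2)
      qed simp
    qed
    then show "multiplicity r k \<le> multiplicity r (?L * ((2 * m) choose m))"
      unfolding e_def[symmetric] using L0 C0 r
      by (intro multiplicity_geI) (auto intro: not_prime_unit)
  qed
qed

text \<open>Passing from m to 2m costs at most the central binomial coefficient, which is bounded by
  4^m; this is just the growth that the bound 4^m allows.\<close>

lemma Lcm_two_power_le: "Lcm {1..2 ^ s :: nat} \<le> 4 ^ (2 ^ s)"
proof (induction s)
  case (Suc s)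
  let ?m = "2 ^ s :: nat"
  have "Lcm {1..2 * ?m} \<le> Lcm {1..?m} * ((2 * ?m) choose ?m)"
    by (rule dvd_imp_le[OF Lcm_double_dvd]) (use Lcm_pos[of ?m] in simp)
  also have "\<dots> \<le> 4 ^ ?m * 2 ^ (2 * ?m)"
    by (intro mult_mono Suc.IH binomial_le_pow2) auto
  also have "\<dots> = 4 ^ ?m * 4 ^ ?m" by (simp only: power_mult) simp
  also have "\<dots> = 4 ^ (2 * ?m)" by (simp only: mult_2 power_add)
  finally show ?case by simp
qed simp

lemma Lcm_atLeastAtMost_le:
  fixes m :: nat
  shows "Lcm {1..m} \<le> 16 ^ m"
proof (cases "m = 0")
  case False
  define s where "s = (LEAST s. m \<le> 2 ^ s)"
  have "m \<le> 2 ^ m" by (simp add: less_imp_le)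
  then have s: "m \<le> 2 ^ s" unfolding s_def by (rule LeastI)
  \<comment> \<open>Rounding up to a power of two at most doubles the argument, whence the base 4^2
    = 16.\<close>
  have s2: "2 ^ s \<le> 2 * m"
  proof (cases s)
    case (Suc t)
    then have "\<not> m \<le> 2 ^ t" using not_less_Least[of t "\<lambda>s. m \<le> 2 ^ s"] by (simp add: s_def)
    then show ?thesis using Suc by simp
  qed (use False in simp)
  have "Lcm {1..m} dvd Lcm {1..2 ^ s}"
    using s by (intro Lcm_subset) auto
  then have "Lcm {1..m} \<le> Lcm {1..2 ^ s}"
    by (rule dvd_imp_le) (rule Lcm_pos)
  also have "\<dots> \<le> 4 ^ (2 ^ s)" by (rule Lcm_two_power_le)
  also have "\<dots> \<le> 4 ^ (2 * m)" using s2 by (intro power_increasing) auto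
  also have "\<dots> = 16 ^ m" by (simp add: power_mult)
  finally show ?thesis .
qed simp

section \<open>Pochhammer numerators: dividing by n! costs only powers of d\<close>

text \<open>Legendre's formula, with the exponents cut at n since r^j > n for j > n; the floors sum
  to at most n (1/2 + 1/4 + ...) <= n.\<close>

lemma multiplicity_fact_le:
  fixes r :: nat
  assumes "prime r"
  shows "multiplicity r (fact n) \<le> n"
proof -
  have mult: "multiplicity r k = (\<Sum>j=1..n. if r ^ j dvd k then 1 else 0)" if k: "k \<in> {1..n}" for k
  proof -
    have le: "multiplicity r k \<le> n"
    proof -
      have "multiplicity r k < 2 ^ multiplicity r k" by simp
      also have "\<dots> \<le> r ^ multiplicity r k"
        using prime_ge_2_nat[OF assms] by (intro power_mono) auto
      also have "\<dots> \<le> k" using k by (intro dvd_imp_le multiplicity_dvd) auto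
      finally show ?thesis using k by simp
    qed
    have "r ^ j dvd k \<longleftrightarrow> j \<le> multiplicity r k" for j
      using k assms by (intro power_dvd_iff_le_multiplicity) (auto intro: not_prime_unit)
    then have "(\<Sum>j=1..n. if r ^ j dvd k then 1 else 0) = (\<Sum>j\<in>{1..n} \<inter> {..multiplicity r k}. 1::nat)"
      by (subst sum.inter_restrict) auto
    also have "{1..n} \<inter> {..multiplicity r k} = {1..multiplicity r k}" using le by auto
    finally show ?thesis by simp
  qed
  have count: "(\<Sum>k=1..n. if x dvd k then 1 else 0) = n div x" if "x > 0" for x
  proof -
    have "{k\<in>{1..n}. x dvd k} = (\<lambda>i. x * i) ` {1..n div x}"
    proof (intro equalityI subsetI)
      fix k assume "k \<in> {k\<in>{1..n}. x dvd k}"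
      then obtain i where i: "k = x * i" "1 \<le> k" "k \<le> n" by auto
      then have "i \<in> {1..n div x}" using that by (auto simp: less_eq_div_iff_mult_less_eq mult_ac Suc_le_eq)
      then show "k \<in> (\<lambda>i. x * i) ` {1..n div x}" using i by blast
    qed (use that in \<open>auto simp: less_eq_div_iff_mult_less_eq mult_ac Suc_le_eq\<close>)
    moreover have "inj_on (\<lambda>i. x * i) {1..n div x}" using that by (intro inj_onI) simp
    ultimately have "card {k\<in>{1..n}. x dvd k} = n div x" by (simp add: card_image)
    then show ?thesis by (simp add: sum.If_cases Int_def)
  qed
  have "multiplicity r (fact n) = (\<Sum>k=1..n. multiplicity r k)"
    unfolding fact_prod using assms by (simp add: prime_elem_multiplicity_prod_distrib prime_imp_prime_elem)
  also have "\<dots> = (\<Sum>k=1..n. \<Sum>j=1..n. if r ^ j dvd k then 1 else 0)"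
    by (intro sum.cong mult) auto
  also have "\<dots> = (\<Sum>j=1..n. n div r ^ j)"
    using assms by (subst sum.swap, intro sum.cong count) (auto simp: prime_gt_0_nat)
  finally have eq: "multiplicity r (fact n) = (\<Sum>j=1..n. n div r ^ j)" .
  have "real (\<Sum>j=1..n. n div r ^ j) \<le> (\<Sum>j=1..n. real n * (1/2) ^ j)"
    unfolding of_nat_sum
  proof (rule sum_mono)
    fix j
    have "real (n div r ^ j) \<le> real n / real (r ^ j)" by (rule of_nat_div_le_of_nat)
    also have "\<dots> \<le> real n / 2 ^ j"
      using prime_ge_2_nat[OF assms] by (intro divide_left_mono) (auto intro!: power_mono)
    finally show "real (n div r ^ j) \<le> real n * (1/2) ^ j" by (simp add: power_one_over)
  qed
  also have "\<dots> = real n * (\<Sum>j=1..n. (1/2) ^ j)" by (simp add: sum_distrib_left)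
  also have "\<dots> \<le> real n * 1"
    by (intro mult_left_mono) (auto simp: sum_gp)
  finally have "real (\<Sum>j=1..n. n div r ^ j) \<le> real n" by (simp add: mult_left_mono)
  then show ?thesis unfolding eq by (simp only: of_nat_le_iff)
qed

text \<open>Prime by prime. If r divides d, the factor d^n suffices by
  \<open>multiplicity_fact_le\<close>. Otherwise d has an inverse e modulo the power of r in n!, and
  multiplying the progression termwise by e turns it into n consecutive integers, whose product is
  divisible by n!.\<close>

lemma fact_dvd_power_times_prod:
  fixes u :: int and d n :: nat
  assumes "d > 0"
  shows "fact n dvd int d ^ n * (\<Prod>i<n. u + int d * int i)"
proof (cases "(\<Prod>i<n. u + int d * int i) = 0")
  case False
  define P where "P = (\<Prod>i<n. u + int d * int i)"
  have "fact n dvd nat \<bar>int d ^ n * P\<bar>"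
  proof (rule multiplicity_le_imp_dvd)
    fix r :: nat assume r: "prime r"
    define v where "v = multiplicity r (fact n)"
    have "r ^ v dvd nat \<bar>int d ^ n * P\<bar>"
    proof (cases "r dvd d")
      case True
      have "r ^ v dvd d ^ n"
        using multiplicity_fact_le[OF r, of n] True unfolding v_def
        by (meson dvd_power_same dvd_trans le_imp_power_dvd)
      then show ?thesis by (simp add: abs_mult nat_mult_distrib nat_power_eq)
    next
      case False
      then have "coprime (int d) (int (r ^ v))"
        using prime_imp_coprime[OF r, of d] by (simp add: coprime_commute)
      then obtain e f where ef: "e * int d + f * int (r ^ v) = 1"
        using bezout_int[of "int d" "int (r ^ v)"] by auto
      have "e ^ n * P = (\<Prod>i<n. e * (u + int d * int i))"
        by (simp add: P_def prod.distrib)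
      also have "\<dots> mod int (r ^ v) = (\<Prod>i<n. e * (u + int d * int i) mod int (r ^ v)) mod int (r ^ v)"
        by (simp only: mod_prod_eq)
      also have "e * (u + int d * int i) mod int (r ^ v) = (e * u + int i) mod int (r ^ v)" for i
      proof -
        have "e * (u + int d * int i) = (e * u + int i) + int (r ^ v) * (- (f * int i))"
          using ef by algebra
        then show ?thesis by (simp only: mod_mult_self2)
      qed
      then have "(\<Prod>i<n. e * (u + int d * int i) mod int (r ^ v)) mod int (r ^ v)
          = (\<Prod>i<n. e * u + int i) mod int (r ^ v)"
        by (simp only: mod_prod_eq)
      also have "(\<Prod>i<n. e * u + int i) = pochhammer (e * u) n"
        by (simp add: pochhammer_prod atLeast0LessThan)
      also have "\<dots> mod int (r ^ v) = 0"
      proof -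
        have "int (r ^ v) dvd int (fact n)"
          unfolding v_def of_nat_dvd_iff by (rule multiplicity_dvd)
        then show ?thesis using fact_dvd_pochhammer[of n "e * u"] by (auto intro: dvd_trans)
      qed
      finally have "int (r ^ v) dvd e ^ n * P" by auto
      moreover have "coprime (int (r ^ v)) (e ^ n)"
      proof -
        have "coprime (int (r ^ v)) e"
          using ef by (intro coprimeI) (metis dvd_add dvd_mult2 dvd_mult dvd_refl)
        then show ?thesis by simp
      qed
      ultimately have "int (r ^ v) dvd P"
        by (simp add: coprime_dvd_mult_right_iff)
      then have "int (r ^ v) dvd int d ^ n * P" by simp
      then show ?thesis by (simp only: int_dvd_int_iff[symmetric] int_nat_eq abs_ge_zero dvd_abs_iff if_True)
    qed
    moreover have "nat \<bar>int d ^ n * P\<bar> \<noteq> 0" using False assms by (simp add: P_def)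
    ultimately show "multiplicity r (fact n) \<le> multiplicity r (nat \<bar>int d ^ n * P\<bar>)"
      unfolding v_def[symmetric] using r
      by (intro multiplicity_geI) (auto intro: not_prime_unit)
  qed auto
  then have "int (fact n) dvd int (nat \<bar>int d ^ n * P\<bar>)" by (simp only: of_nat_dvd_iff)
  then show ?thesis by (simp add: P_def)
qed (simp only: mult_zero_right dvd_0_right)

text \<open>Half of the 2n factors d make the n linear factors integral; the other half pay for the
  division by n!.\<close>

lemma fact_dvd_pochhammer_rational:
  fixes x :: real
  assumes "d > 0" "real d * x \<in> \<int>"
  shows "real d ^ (2 * n) * (pochhammer x n / fact n) \<in> \<int>"
proof -
  obtain u where u: "real d * x = real_of_int u" using assms(2) by (auto elim: Ints_cases)
  obtain w where w: "int d ^ n * (\<Prod>i<n. u + int d * int i) = fact n * w"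
    using fact_dvd_power_times_prod[OF assms(1), of n u] by (auto elim: dvdE)
  have "real d ^ n * pochhammer x n = (\<Prod>i<n. real d * (x + real i))"
    by (simp add: pochhammer_prod atLeast0LessThan prod.distrib)
  also have "\<dots> = (\<Prod>i<n. real_of_int (u + int d * int i))"
    using u by (simp add: algebra_simps)
  finally have "real d ^ (2 * n) * pochhammer x n = real_of_int (int d ^ n * (\<Prod>i<n. u + int d * int i))"
    by (simp add: mult_2 power_add mult.assoc)
  also have "\<dots> = fact n * real_of_int w" unfolding w by simp
  finally show ?thesis by simp
qed

section \<open>Pochhammer denominators: partial fractions and the lcm\<close>

text \<open>Pascal's rule writes the sum of order n + 1 at x as the difference of the sums of order
  n at x and x + 1. The point of the expansion is that a common denominator of simple fractions is
  an lcm instead of a product.\<close>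

lemma fact_div_pochhammer_partial_fraction:
  fixes x :: real
  assumes "x > 0"
  shows "fact n / pochhammer x (Suc n) = (\<Sum>i\<le>n. (-1) ^ i * real (n choose i) / (x + real i))"
  using assms
proof (induction n arbitrary: x)
  case (Suc n)
  let ?f = "\<lambda>x n i. (-1) ^ i * real (n choose i) / (x + real i)"
  have pos: "pochhammer y k > 0" if "y > 0" for y :: real and k using that by (rule pochhammer_pos)
  have "(\<Sum>i\<le>Suc n. ?f x (Suc n) i) = (\<Sum>i\<le>n. ?f x n i) - (\<Sum>i\<le>n. ?f (x + 1) n i)"
  proof -
    have "(\<Sum>i\<le>Suc n. ?f x (Suc n) i) = 1 / x + (\<Sum>i\<le>n. ?f x (Suc n) (Suc i))"
      by (subst sum.atMost_Suc_shift) simp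
    also have "(\<Sum>i\<le>n. ?f x (Suc n) (Suc i)) = (\<Sum>i\<le>n. ?f x n (Suc i)) - (\<Sum>i\<le>n. ?f (x + 1) n i)"
      by (subst sum_subtractf[symmetric], rule sum.cong)
         (auto simp: algebra_simps add_divide_distrib diff_divide_distrib)
    also have "1 / x + ((\<Sum>i\<le>n. ?f x n (Suc i)) - S) = (\<Sum>i\<le>n. ?f x n i) - S" for S
    proof -
      have "(\<Sum>i\<le>Suc n. ?f x n i) = 1 / x + (\<Sum>i\<le>n. ?f x n (Suc i))"
        by (subst sum.atMost_Suc_shift) simp
      then show ?thesis by (simp add: binomial_eq_0)
    qed
    finally show ?thesis .
  qed
  also have "\<dots> = fact n / pochhammer x (Suc n) - fact n / pochhammer (x + 1) (Suc n)"
    using Suc.prems by (simp add: Suc.IH)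
  also have "\<dots> = fact (Suc n) / pochhammer x (Suc (Suc n))"
  proof -
    let ?Q = "pochhammer (x + 1) n"
    have Q: "?Q > 0" using Suc.prems by (intro pos) simp
    have e1: "pochhammer x (Suc n) = x * ?Q" by (simp add: pochhammer_rec)
    have e2: "pochhammer (x + 1) (Suc n) = ?Q * (x + 1 + real n)" by (simp add: pochhammer_Suc)
    have e3: "pochhammer x (Suc (Suc n)) = x * (?Q * (x + 1 + real n))"
      by (simp only: pochhammer_rec[of x "Suc n"] e2)
    define w where "w = x + 1 + real n"
    have "w \<noteq> 0" using Suc.prems by (simp add: w_def)
    then have "fact n / (x * ?Q) - fact n / (?Q * w) = (w - x) * fact n / (x * (?Q * w))"
      using Q Suc.prems by (simp add: field_simps)
    moreover have "(w - x) * fact n = fact (Suc n)" by (simp add: w_def)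
    ultimately show ?thesis unfolding e1 e2 e3 w_def[symmetric] by simp
  qed
  finally show ?case ..
qed simp

text \<open>After scaling by d, each denominator in the partial fraction expansion is an integer
  between 1 and m, so it divides the lcm.\<close>

lemma Lcm_mult_fact_div_pochhammer_Ints:
  fixes x :: real
  assumes d: "real d * x \<in> \<int>" "d > 0" and x: "x > 0" and m: "real d * (x + real n) \<le> real m"
  shows "real (Lcm {1..m}) * (fact n / pochhammer x (Suc n)) \<in> \<int>"
  unfolding fact_div_pochhammer_partial_fraction[OF x] sum_distrib_left
proof (rule Ints_sum)
  fix i assume i: "i \<in> {..n}"
  have "real d * (x + real i) \<in> \<int>" using d(1) by (auto simp: distrib_left intro: Ints_add)
  then obtain w where w: "real d * (x + real i) = real_of_int w" by (auto elim: Ints_cases)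
  have "0 < real d * (x + real i)" using d x by simp
  then have w0: "w > 0" using w by simp
  have "real d * (x + real i) \<le> real d * (x + real n)" using i by (intro mult_left_mono) auto
  then have "w \<le> int m" using m w by linarith
  then have "nat w dvd Lcm {1..m}" using w0 by (intro dvd_Lcm) auto
  then obtain v where v: "Lcm {1..m} = nat w * v" by (auto elim: dvdE)
  have e: "x + real i = real_of_int w / real d" using w d(2) by (simp add: field_simps)
  have "real (Lcm {1..m}) / (x + real i) = real (d * v)"
    unfolding v e using w0 d(2) by (simp add: field_simps)
  then have "real (Lcm {1..m}) * ((-1) ^ i * real (n choose i) / (x + real i))
      = (-1) ^ i * real (n choose i) * real (d * v)"
    by (metis (no_types, opaque_lifting) mult.commute mult.left_commute times_divide_eq_right)
  also have "\<dots> \<in> \<int>" by (intro Ints_mult Ints_power) auto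
  finally show "real (Lcm {1..m}) * ((-1) ^ i * real (n choose i) / (x + real i)) \<in> \<int>" .
qed

section \<open>Finite differences and polynomials\<close>

definition shift_poly :: "real poly \<Rightarrow> real \<Rightarrow> real poly" where
  "shift_poly P s = pcompose P [:s, 1:]"

lemma poly_shift_poly [simp]: "poly (shift_poly P s) x = poly P (x + s)"
  by (simp add: shift_poly_def poly_pcompose add.commute)

lemma degree_shift_poly [simp]: "degree (shift_poly P s) = degree P"
  by (simp add: shift_poly_def degree_pcompose)

lemma shift_poly_mult: "shift_poly (P * Q) s = shift_poly P s * shift_poly Q s"
  by (simp add: shift_poly_def pcompose_mult)

lemma shift_poly_shift_poly: "shift_poly (shift_poly P s) t = shift_poly P (s + t)"
  by (rule poly_eq_poly_eq_iff[THEN iffD1]) (simp add: fun_eq_iff add_ac)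

lemma shift_poly_0 [simp]: "shift_poly P 0 = P"
  by (rule poly_eq_poly_eq_iff[THEN iffD1]) (simp add: fun_eq_iff)

lemma degree_shift_poly_diff:
  assumes "degree P > 0"
  shows "degree (shift_poly P s - P) < degree P"
proof (cases "shift_poly P s = P")
  case False
  have "lead_coeff (shift_poly P s) = lead_coeff P"
    unfolding shift_poly_def by (subst lead_coeff_comp) auto
  then have "coeff (shift_poly P s - P) (degree P) = 0" by simp
  moreover have "degree (shift_poly P s - P) \<le> degree P"
    by (intro degree_diff_le) auto
  ultimately show ?thesis using False
    by (metis leading_coeff_0_iff le_neq_implies_less right_minus_eq)
qed (use assms in simp)

text \<open>By Pascal's rule the sum of order N + 1 for P is minus the sum of order N for the
  forward difference of P, which has smaller degree unless P is constant.\<close>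

lemma alternating_binomial_sum_poly_eq_0:
  fixes P :: "real poly"
  assumes "degree P < N"
  shows "(\<Sum>s\<le>N. (-1) ^ s * real (N choose s) * poly P (x + real s)) = 0"
  using assms
proof (induction N arbitrary: P)
  case (Suc N)
  let ?f = "\<lambda>s. poly P (x + real s)"
  have "(\<Sum>s\<le>Suc N. (-1) ^ s * real (Suc N choose s) * ?f s)
      = - (\<Sum>s\<le>N. (-1) ^ s * real (N choose s) * poly (shift_poly P 1 - P) (x + real s))"
  proof -
    have "(\<Sum>s\<le>Suc N. (-1) ^ s * real (Suc N choose s) * ?f s)
        = ?f 0 - (\<Sum>s\<le>N. (-1) ^ s * real (N choose Suc s) * ?f (Suc s))
            - (\<Sum>s\<le>N. (-1) ^ s * real (N choose s) * ?f (Suc s))"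
      by (subst sum.atMost_Suc_shift) (simp add: algebra_simps sum.distrib sum_negf sum_subtractf)
    also have "?f 0 - (\<Sum>s\<le>N. (-1) ^ s * real (N choose Suc s) * ?f (Suc s))
        = (\<Sum>s\<le>Suc N. (-1) ^ s * real (N choose s) * ?f s)"
      by (subst sum.atMost_Suc_shift) (simp add: sum_negf)
    also have "\<dots> = (\<Sum>s\<le>N. (-1) ^ s * real (N choose s) * ?f s)"
      by (simp add: binomial_eq_0)
    finally show ?thesis by (simp add: algebra_simps sum_subtractf)
  qed
  also have "(\<Sum>s\<le>N. (-1) ^ s * real (N choose s) * poly (shift_poly P 1 - P) (x + real s)) = 0"
  proof (cases "degree P = 0")
    case True
    then obtain v where "P = [:v:]" by (auto elim: degree_eq_zeroE)
    then show ?thesis by simp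
  next
    case False
    then show ?thesis using degree_shift_poly_diff[of P 1] Suc.prems by (intro Suc.IH) simp
  qed
  finally show ?case by simp
qed simp

lemma ex_interpolating_poly:
  fixes h :: "nat \<Rightarrow> real"
  shows "\<exists>A. degree A \<le> N \<and> (\<forall>l\<le>N. poly A (real l) = h l)"
proof (induction N)
  case 0
  show ?case by (rule exI[of _ "[:h 0:]"]) simp
next
  case (Suc N)
  then obtain A where A: "degree A \<le> N" "\<And>l. l \<le> N \<Longrightarrow> poly A (real l) = h l" by blast
  \<comment> \<open>Newton interpolation: a multiple of \<open>Q\<close> corrects the value at the
    new node without disturbing the old ones.\<close>
  define Q where "Q = (\<Prod>l\<le>N. [:- real l, 1:])"
  have "poly Q (real (Suc N)) \<noteq> 0" by (auto simp: Q_def poly_prod)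
  moreover have "poly Q (real l) = 0" if "l \<le> N" for l
    using that by (auto simp: Q_def poly_prod)
  moreover have "degree Q = Suc N"
    unfolding Q_def by (subst degree_prod_eq_sum_degree) auto
  moreover define v where "v = (h (Suc N) - poly A (real (Suc N))) / poly Q (real (Suc N))"
  ultimately have "degree (A + smult v Q) \<le> Suc N" "poly (A + smult v Q) (real (Suc N)) = h (Suc N)"
    "\<And>l. l \<le> N \<Longrightarrow> poly (A + smult v Q) (real l) = h l"
    using A by (auto intro!: degree_add_le simp del: of_nat_Suc)
  then show ?case by (metis le_Suc_eq)
qed

text \<open>Vanishing N-th differences form a linear recurrence whose top coefficient is 1 or -1, so
  the first N values determine the rest. The polynomial interpolating these N values obeys the same
  recurrence.\<close>

lemma ex_poly_of_alternating_binomial_sums: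
  fixes h :: "nat \<Rightarrow> real"
  assumes N: "N > 0"
    and zero: "\<And>i. i + N \<le> X \<Longrightarrow> (\<Sum>s\<le>N. (-1) ^ s * real (N choose s) * h (i + s)) = 0"
  obtains A where "degree A < N" "\<And>l. l \<le> X \<Longrightarrow> poly A (real l) = h l"
proof -
  obtain A where A: "degree A \<le> N - 1" "\<And>l. l \<le> N - 1 \<Longrightarrow> poly A (real l) = h l"
    using ex_interpolating_poly by blast
  have deg: "degree A < N" using A(1) N by simp
  have "poly A (real l) = h l" if "l \<le> X" for l
    using that
  proof (induction l rule: less_induct)
    case (less l)
    show ?case
    proof (cases "l < N")
      case False
      define i where "i = l - N"
      have l: "l = i + N" using False by (simp add: i_def)
      let ?w = "\<lambda>s. (-1) ^ s * real (N choose s)"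
      have "(\<Sum>s\<le>N. ?w s * (poly A (real (i + s)) - h (i + s))) = 0"
        using alternating_binomial_sum_poly_eq_0[OF deg, of "real i"] zero[of i] l less.prems
        by (simp add: right_diff_distrib sum_subtractf)
      also have "{..N} = insert N {..<N}" by auto
      finally have "?w N * (poly A (real (i + N)) - h (i + N))
          + (\<Sum>s<N. ?w s * (poly A (real (i + s)) - h (i + s))) = 0" by simp
      moreover have "(\<Sum>s<N. ?w s * (poly A (real (i + s)) - h (i + s))) = 0"
        using less l by (intro sum.neutral) (auto simp del: of_nat_add)
      ultimately show ?thesis using l by simp
    qed (use A(2) in simp)
  qed
  with deg show ?thesis by (rule that)
qed

text \<open>Roots are moved into H one at a time, so coinciding values of \<open>c\<close> are
  counted with multiplicity.\<close>

lemma prod_linear_dvd_cancel: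
  fixes F H :: "real poly"
  assumes "finite I" "(\<Prod>i\<in>I. [:c i, 1:]) dvd F * H" "\<And>i. i \<in> I \<Longrightarrow> poly F (- c i) \<noteq> 0"
  shows "(\<Prod>i\<in>I. [:c i, 1:]) dvd H"
  using assms
proof (induction I arbitrary: H rule: finite_induct)
  case (insert j I)
  have prod: "(\<Prod>i\<in>insert j I. [:c i, 1:]) = [:c j, 1:] * (\<Prod>i\<in>I. [:c i, 1:])"
    using insert.hyps by (rule prod.insert)
  have "[:c j, 1:] dvd F * H"
    using insert.prems(1) unfolding prod by (rule dvd_mult_left)
  then have "poly (F * H) (- c j) = 0" using poly_eq_0_iff_dvd[of "F * H" "- c j"] by simp
  then have "poly H (- c j) = 0" using insert.prems(2)[of j] by simp
  then obtain H' where H': "H = [:c j, 1:] * H'" using poly_eq_0_iff_dvd[of H "- c j"] by (auto elim: dvdE)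
  have "[:c j, 1:] * (\<Prod>i\<in>I. [:c i, 1:]) dvd [:c j, 1:] * (F * H')"
    using insert.prems(1) unfolding prod H' by (simp only: mult.left_commute)
  then have "(\<Prod>i\<in>I. [:c i, 1:]) dvd F * H'" by (simp only: dvd_mult_cancel_left) simp
  then have "(\<Prod>i\<in>I. [:c i, 1:]) dvd H'" using insert by blast
  then show ?case unfolding prod H' by (intro mult_dvd_mono) auto
qed simp

section \<open>The recurrence and its rational solutions\<close>

text \<open>The real images of the rational data, with rationality expressed by one common
  denominator \<open>d\<close>. It is \<open>1 / z\<close> whose denominator is controlled, because
  only nonpositive powers of z occur in \<open>y\<close>. \<open>ab_Nats\<close> includes h = i, a
  case covered by a_i < b_i.\<close>

locale hyp_params =
  fixes p q d :: nat and a b :: "nat \<Rightarrow> real" and z :: real and lam :: "nat \<Rightarrow> real"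
  assumes pq: "p < q" and d_pos: "d > 0" and z_nz: "z \<noteq> 0"
    and a_gt: "i \<in> {1..p} \<Longrightarrow> a i > -1"
    and b_gt: "i \<in> {1..q} \<Longrightarrow> b i > -1"
    and a_less_b: "i \<in> {1..p} \<Longrightarrow> a i < b i"
    and a_Ints: "i \<in> {1..p} \<Longrightarrow> real d * a i \<in> \<int>"
    and b_Ints: "i \<in> {1..q} \<Longrightarrow> real d * b i \<in> \<int>"
    and z_Ints: "real d * (1 / z) \<in> \<int>"
    and lam_Ints: "j \<le> q \<Longrightarrow> real d * lam j \<in> \<int>"
    and ab_Nats: "h \<in> {1..p} \<Longrightarrow> i \<in> {1..q} \<Longrightarrow> a h - b i \<notin> \<nat>"
    and bb_Nats: "h \<in> {1..q} \<Longrightarrow> i \<in> {1..q} \<Longrightarrow> h \<noteq> i \<Longrightarrow> b h - b i \<notin> \<nat>"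
    and lam_nz: "\<exists>j\<in>{1..q}. lam j \<noteq> 0"
begin

definition A\<^sub>p :: "real poly" where "A\<^sub>p = (\<Prod>i=1..p. [:a i + 1, 1:])"
definition B\<^sub>p :: "real poly" where "B\<^sub>p = (\<Prod>i=1..q. [:b i + 1, 1:])"
text \<open>The numerator obtained when the fractions lam_j / ((b_1 + 1 + x) ... (b_j + 1 + x)) are
  brought to the denominator B(x); see \<open>G_div_B\<close>.\<close>

definition G\<^sub>p :: "real poly" where
  "G\<^sub>p = (\<Sum>j=1..q. smult (lam j) (\<Prod>i=j+1..q. [:b i + 1, 1:]))"
definition V\<^sub>p :: "nat \<Rightarrow> real poly" where "V\<^sub>p n = (\<Prod>s<n. shift_poly B\<^sub>p (real s))"

abbreviation "A \<equiv> poly A\<^sub>p"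
abbreviation "B \<equiv> poly B\<^sub>p"
abbreviation "G \<equiv> poly G\<^sub>p"
abbreviation "V n \<equiv> poly (V\<^sub>p n)"

lemma A_eq: "A x = (\<Prod>i=1..p. a i + 1 + x)" by (simp add: A\<^sub>p_def poly_prod)
lemma B_eq: "B x = (\<Prod>i=1..q. b i + 1 + x)" by (simp add: B\<^sub>p_def poly_prod)
lemma G_eq: "G x = (\<Sum>j=1..q. lam j * (\<Prod>i=j+1..q. b i + 1 + x))"
  by (simp add: G\<^sub>p_def poly_sum poly_prod)
lemma V_eq: "V n x = (\<Prod>s<n. B (x + real s))" by (simp add: V\<^sub>p_def poly_prod)

lemma degree_A: "degree A\<^sub>p = p" unfolding A\<^sub>p_def by (subst degree_prod_eq_sum_degree) auto
lemma degree_B: "degree B\<^sub>p = q" unfolding B\<^sub>p_def by (subst degree_prod_eq_sum_degree) auto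

lemma degree_linear_prod: "degree (\<Prod>i=j+1..q. [:b i + 1, 1:]) = q - j"
  by (subst degree_prod_eq_sum_degree) auto

lemma degree_G: "degree G\<^sub>p < q"
proof -
  have "degree G\<^sub>p \<le> q - 1" unfolding G\<^sub>p_def
  proof (rule degree_sum_le)
    fix j assume "j \<in> {1..q}"
    then show "degree (smult (lam j) (\<Prod>i=j+1..q. [:b i + 1, 1:])) \<le> q - 1"
      by (intro order.trans[OF degree_smult_le]) (auto simp: degree_linear_prod simp del: One_nat_def)
  qed simp
  then show ?thesis using pq by simp
qed

text \<open>The products in \<open>G\<^sub>p\<close> are monic of distinct degrees q - j, so the
  smallest j with lam_j nonzero gives the leading coefficient.\<close>

lemma G_nz: "G\<^sub>p \<noteq> 0"
proof -
  define j where "j = (LEAST j. j \<in> {1..q} \<and> lam j \<noteq> 0)"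
  have j: "j \<in> {1..q} \<and> lam j \<noteq> 0" unfolding j_def by (rule LeastI_ex) (use lam_nz in blast)
  let ?P = "\<lambda>j. \<Prod>i=j+1..q. [:b i + 1, 1:]"
  have P1: "coeff (?P j) (q - j) = 1"
  proof -
    have "lead_coeff (?P j) = 1" by (simp add: lead_coeff_prod)
    then show ?thesis by (simp only: degree_linear_prod)
  qed
  have "coeff G\<^sub>p (q - j) = (\<Sum>i=1..q. lam i * coeff (?P i) (q - j))"
    by (simp add: G\<^sub>p_def coeff_sum)
  also have "\<dots> = (\<Sum>i\<in>{1..q}. if i = j then lam j else 0)"
  proof (rule sum.cong)
    fix i assume i: "i \<in> {1..q}"
    consider "i < j" | "i = j" | "i > j" by linarith
    then show "lam i * coeff (?P i) (q - j) = (if i = j then lam j else 0)"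
    proof cases
      case 1
      then have "lam i = 0" using not_less_Least[of i "\<lambda>j. j \<in> {1..q} \<and> lam j \<noteq> 0"] i
        unfolding j_def by blast
      then show ?thesis using 1 by simp
    next
      case 2
      then show ?thesis using P1 by simp
    next
      case 3
      then have "degree (?P i) < q - j" using i j by (simp only: degree_linear_prod) auto
      then show ?thesis using 3 by (simp add: coeff_eq_0)
    qed
  qed simp
  also have "\<dots> = lam j" using j by simp
  finally show ?thesis using j by auto
qed

text \<open>The equation says that \<open>Y = P / V\<^sub>p n\<close> solves \<open>z A(x) Y(x+1) = B(x) Y(x) + G(x)\<close>. The leftmost
  pole of such a \<open>Y\<close> cannot be cancelled, so \<open>Y\<close> would be a polynomial, which is impossible for
  degree reasons.\<close>

lemma no_rational_solution:
  "smult z (A\<^sub>p * B\<^sub>p * shift_poly P 1) \<noteq> shift_poly B\<^sub>p (real n) * (B\<^sub>p * P + G\<^sub>p * V\<^sub>p n)"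
proof (induction n arbitrary: P)
  case 0
  have B0: "B\<^sub>p \<noteq> 0" using degree_B pq by auto
  show ?case
  proof
    assume "smult z (A\<^sub>p * B\<^sub>p * shift_poly P 1) = shift_poly B\<^sub>p (real 0) * (B\<^sub>p * P + G\<^sub>p * V\<^sub>p 0)"
    then have "B\<^sub>p * smult z (A\<^sub>p * shift_poly P 1) = B\<^sub>p * (B\<^sub>p * P + G\<^sub>p)"
      by (simp add: V\<^sub>p_def mult_ac)
    then have eq: "smult z (A\<^sub>p * shift_poly P 1) = B\<^sub>p * P + G\<^sub>p"
      using B0 by (simp only: mult_cancel_left simp_thms)
    show False
    proof (cases "P = 0")
      case True
      then show False using eq G_nz by (simp add: shift_poly_def)
    next
      case False
      \<comment> \<open>For a polynomial solution, p < q and deg G < q make the right side of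
        strictly larger degree than the left.\<close>
      have "degree (B\<^sub>p * P) = q + degree P" using B0 False by (simp add: degree_mult_eq degree_B)
      then have "degree (B\<^sub>p * P + G\<^sub>p) = q + degree P"
        using degree_G by (subst degree_add_eq_left) auto
      moreover have "degree (smult z (A\<^sub>p * shift_poly P 1)) \<le> p + degree P"
        by (rule order.trans[OF degree_smult_le], rule order.trans[OF degree_mult_le])
           (simp add: degree_A)
      ultimately show False using eq pq by simp
    qed
  qed
next
  case (Suc n)
  let ?s = "real (Suc n)"
  show ?case
  proof
    assume eq: "smult z (A\<^sub>p * B\<^sub>p * shift_poly P 1) = shift_poly B\<^sub>p ?s * (B\<^sub>p * P + G\<^sub>p * V\<^sub>p (Suc n))"
    have shiftB: "shift_poly B\<^sub>p ?s = (\<Prod>i=1..q. [:b i + 1 + ?s, 1:])"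
      by (simp add: B\<^sub>p_def shift_poly_def pcompose_prod pcompose_pCons add_ac)
    have B0: "shift_poly B\<^sub>p ?s \<noteq> 0" unfolding shiftB by auto
    \<comment> \<open>A common root of B(x + n + 1) and A(x) B(x) would make some a_h - b_i or b_h -
      b_i equal to n + 1, which the hypotheses exclude. Hence all of B(x + n + 1) must divide P(x +
      1).\<close>
    have "shift_poly B\<^sub>p ?s dvd smult z (A\<^sub>p * B\<^sub>p * shift_poly P 1)" unfolding eq by simp
    then have "shift_poly B\<^sub>p ?s dvd (A\<^sub>p * B\<^sub>p) * shift_poly P 1"
      using z_nz by (simp add: dvd_smult_iff)
    then have "shift_poly B\<^sub>p ?s dvd shift_poly P 1" unfolding shiftB
    proof (rule prod_linear_dvd_cancel[rotated])
      fix i assume i: "i \<in> {1..q}"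
      let ?x = "- (b i + 1 + ?s)"
      have "a h + 1 + ?x \<noteq> 0" if "h \<in> {1..p}" for h
      proof
        assume "a h + 1 + ?x = 0"
        then have "a h - b i = ?s" by simp
        then show False using ab_Nats[OF that i] by (metis of_nat_in_Nats)
      qed
      moreover have "b h + 1 + ?x \<noteq> 0" if "h \<in> {1..q}" for h
      proof
        assume "b h + 1 + ?x = 0"
        then have e: "b h - b i = ?s" by simp
        then have "h \<noteq> i" by auto
        then show False using bb_Nats[OF that i] e by (metis of_nat_in_Nats)
      qed
      ultimately show "poly (A\<^sub>p * B\<^sub>p) ?x \<noteq> 0" by (simp add: A_eq B_eq)
    qed simp
    then obtain H where H: "shift_poly P 1 = shift_poly B\<^sub>p ?s * H" by (auto elim: dvdE)
    \<comment> \<open>Then P = B(x + n) P', so P / V_(n+1) = P' / V_n and the induction hypothesis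
      applies to P'.\<close>
    define P' where "P' = shift_poly H (-1)"
    have H': "H = shift_poly P' 1" by (simp add: P'_def shift_poly_shift_poly)
    have "P = shift_poly (shift_poly P 1) (-1)" by (simp add: shift_poly_shift_poly)
    also have "\<dots> = shift_poly B\<^sub>p (real n) * P'"
      unfolding H shift_poly_mult P'_def by (simp add: shift_poly_shift_poly)
    finally have P: "P = shift_poly B\<^sub>p (real n) * P'" .
    have "shift_poly B\<^sub>p ?s * smult z (A\<^sub>p * B\<^sub>p * shift_poly P' 1) = smult z (A\<^sub>p * B\<^sub>p * shift_poly P 1)"
      unfolding H H' by (simp add: mult_ac)
    also have "\<dots> = shift_poly B\<^sub>p ?s * (shift_poly B\<^sub>p (real n) * (B\<^sub>p * P' + G\<^sub>p * V\<^sub>p n))"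
      unfolding eq by (subst P) (simp add: V\<^sub>p_def algebra_simps)
    finally have "smult z (A\<^sub>p * B\<^sub>p * shift_poly P' 1) = shift_poly B\<^sub>p (real n) * (B\<^sub>p * P' + G\<^sub>p * V\<^sub>p n)"
      using B0 by (simp only: mult_cancel_left simp_thms)
    then show False using Suc.IH by blast
  qed
qed

section \<open>Arithmetic of the approximations\<close>

definition c :: "nat \<Rightarrow> real" where "c k = (\<Prod>s<k. A (real s) / B (real s))"

text \<open>The partial sums of the hypothetical relation, divided by the next term up to a bounded factor. The
  relation itself enters only in \<open>hyp_relation\<close>, where \<open>y l\<close> becomes minus a normalized tail.\<close>

definition y :: "nat \<Rightarrow> real" where
  "y l = (lam 0 + (\<Sum>k<l. c k * (G k / B k) * z ^ k)) / (c l * z ^ l)"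

lemma A_pos: "x \<ge> 0 \<Longrightarrow> A x > 0"
  unfolding A_eq using a_gt by (intro prod_pos) fastforce

lemma B_pos: "x \<ge> 0 \<Longrightarrow> B x > 0"
  unfolding B_eq using b_gt by (intro prod_pos) fastforce

lemma c_pos: "c k > 0"
  unfolding c_def by (intro prod_pos) (simp add: A_pos B_pos)

lemma c_0 [simp]: "c 0 = 1" by (simp add: c_def)

lemma c_Suc: "c (Suc k) = c k * (A k / B k)" by (simp add: c_def)

lemma c_add: "c (t + l) = c l * (\<Prod>s<t. A (real l + real s) / B (real l + real s))"
  by (induction t) (simp_all add: c_Suc add_ac)

lemma c_pochhammer:
  "c k = (\<Prod>i=1..p. pochhammer (a i + 1) k) / (\<Prod>i=1..q. pochhammer (b i + 1) k)"
proof -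
  have "c k = (\<Prod>s<k. A (real s)) / (\<Prod>s<k. B (real s))" by (simp add: c_def prod_dividef)
  also have "(\<Prod>s<k. A (real s)) = (\<Prod>i=1..p. pochhammer (a i + 1) k)"
    unfolding A_eq pochhammer_prod atLeast0LessThan by (rule prod.swap)
  also have "(\<Prod>s<k. B (real s)) = (\<Prod>i=1..q. pochhammer (b i + 1) k)"
    unfolding B_eq pochhammer_prod atLeast0LessThan by (rule prod.swap)
  finally show ?thesis .
qed

lemma V_pochhammer: "V n x = (\<Prod>i=1..q. pochhammer (b i + 1 + x) n)"
  unfolding V_eq B_eq pochhammer_prod atLeast0LessThan
  by (subst prod.swap) (simp add: add_ac)

lemma degree_V: "degree (V\<^sub>p n) = q * n"
proof -
  have "shift_poly B\<^sub>p s \<noteq> 0" for s using degree_shift_poly[of B\<^sub>p s] degree_B pq by force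
  then show ?thesis unfolding V\<^sub>p_def by (subst degree_prod_eq_sum_degree) (auto simp: degree_B)
qed

lemma y_rec: "z * A l * y (Suc l) = B l * y l + G l"
proof -
  have nz: "A l \<noteq> 0" "B l \<noteq> 0" "c l \<noteq> 0" using A_pos[of l] B_pos[of l] c_pos[of l] by auto
  let ?s = "lam 0 + (\<Sum>k<l. c k * (G k / B k) * z ^ k)"
  have "z * A l * y (Suc l) = z * A l * ((?s + c l * (G l / B l) * z ^ l) / (c l * (A l / B l) * (z ^ l * z)))"
    by (simp add: y_def c_Suc add_ac mult_ac)
  also have "\<dots> = B l * (?s + c l * (G l / B l) * z ^ l) / (c l * z ^ l)"
    using nz z_nz by (simp add: field_simps)
  also have "\<dots> = B l * (?s / (c l * z ^ l)) + G l"
    using nz z_nz by (simp add: field_simps)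
  finally show ?thesis unfolding y_def[of l] .
qed

section \<open>Common denominators of the y_l and of the values of V_n\<close>

lemma z_power_inverse_Ints:
  assumes "i \<le> X"
  shows "real d ^ X * (1 / z) ^ i \<in> \<int>"
proof -
  have "real d ^ X * (1 / z) ^ i = real d ^ (X - i) * (real d * (1 / z)) ^ i"
    using assms by (simp only: power_mult_distrib mult.assoc[symmetric] power_add[symmetric]) simp
  also have "\<dots> \<in> \<int>" by (intro Ints_mult[OF Ints_power[OF Ints_of_nat] Ints_power[OF z_Ints]])
  finally show ?thesis .
qed

lemma b_shift_Ints: "i \<in> {1..q} \<Longrightarrow> real d * (b i + real k) \<in> \<int>"
  using b_Ints[of i] by (simp add: distrib_left Ints_add)

lemma a_shift_Ints: "i \<in> {1..p} \<Longrightarrow> real d * (a i + real k) \<in> \<int>"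
  using a_Ints[of i] by (simp add: distrib_left Ints_add)

lemma linear_prod_Ints:
  assumes "j \<le> q"
  shows "real d ^ q * (\<Prod>i=j+1..q. b i + 1 + real k) \<in> \<int>"
proof -
  have "real d ^ q * (\<Prod>i=j+1..q. b i + 1 + real k)
      = real d ^ j * (\<Prod>i=j+1..q. real d * (b i + real (Suc k)))"
    using assms by (simp add: prod.distrib power_add[symmetric] mult.assoc[symmetric] add_ac)
  also have "\<dots> \<in> \<int>" by (intro Ints_mult Ints_prod Ints_power b_shift_Ints) auto
  finally show ?thesis .
qed

lemma B_Ints: "real d ^ q * B (real k) \<in> \<int>"
  using linear_prod_Ints[of 0 k] by (simp add: B_eq)

lemma G_Ints: "real d ^ Suc q * G (real k) \<in> \<int>"
proof -
  have "real d ^ Suc q * G (real k)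
      = (\<Sum>j=1..q. (real d * lam j) * (real d ^ q * (\<Prod>i=j+1..q. b i + 1 + real k)))"
    unfolding G_eq sum_distrib_left by (simp add: mult_ac)
  also have "\<dots> \<in> \<int>"
    by (intro Ints_sum Ints_mult[of "real d * lam _"] linear_prod_Ints lam_Ints) auto
  finally show ?thesis .
qed

text \<open>The factor B(k) cancels one factor for each b_i, leaving length r above and r + 1 below.
  These are the lengths for which r! can be split off on both sides.\<close>

lemma c_ratio:
  "c k / (c (Suc r + k) * B k) =
     (\<Prod>i=1..q. pochhammer (b i + 2 + real k) r) / (\<Prod>i=1..p. pochhammer (a i + 1 + real k) (Suc r))"
proof -
  have 1: "(\<Prod>s<Suc r. A (real k + real s)) = (\<Prod>i=1..p. pochhammer (a i + 1 + real k) (Suc r))"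
    unfolding A_eq pochhammer_prod atLeast0LessThan by (subst prod.swap) (simp add: add_ac)
  have 2: "(\<Prod>s<Suc r. B (real k + real s)) = B k * (\<Prod>i=1..q. pochhammer (b i + 2 + real k) r)"
    unfolding prod.lessThan_Suc_shift unfolding B_eq pochhammer_prod atLeast0LessThan
    by (subst prod.swap) (simp add: add_ac)
  have nz: "c k \<noteq> 0" "B k \<noteq> 0" using c_pos[of k] B_pos[of k] by auto
  have "c (Suc r + k) = c k * (\<Prod>i=1..p. pochhammer (a i + 1 + real k) (Suc r))
      / (B k * (\<Prod>i=1..q. pochhammer (b i + 2 + real k) r))"
    unfolding c_add prod_dividef 1 2 by simp
  then show ?thesis using nz by simp
qed

text \<open>Each b_i contributes d^(2X) and each a_i one lcm; \<open>X\<close> bounds the indices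
  and \<open>m\<close> the integers d (a_i + 1 + s) with s <= X.\<close>

definition D :: "nat \<Rightarrow> nat \<Rightarrow> real" where
  "D m X = real d ^ (2 * X * q) * real (Lcm {1..m}) ^ p"

text \<open>For i <= p the numerator for b_i is divided by r! and the reciprocal for a_i multiplied
  by r!, so that both become integral at exponential cost. The numerators with i > p need no such
  division.\<close>

lemma c_ratio_Ints:
  assumes m: "\<And>i. i \<in> {1..p} \<Longrightarrow> real d * (a i + 1 + real X) \<le> real m"
    and l: "Suc r + k \<le> X"
  shows "D m X * (c k / (c (Suc r + k) * B k)) \<in> \<int>"
proof -
  let ?L = "real (Lcm {1..m})"
  let ?P = "\<lambda>i. pochhammer (b i + 2 + real k) r" and ?Q = "\<lambda>i. pochhammer (a i + 1 + real k) (Suc r)"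
  have P: "real d ^ (2 * X) * (?P i / fact r) \<in> \<int>" if i: "i \<in> {1..q}" for i
  proof -
    have "real d * (b i + 2 + real k) \<in> \<int>" using b_shift_Ints[OF i, of "2 + k"] by (simp add: add_ac)
    then have *: "real d ^ (2 * r) * (?P i / fact r) \<in> \<int>"
      by (rule fact_dvd_pochhammer_rational[OF d_pos])
    have "real d ^ (2 * (X - r)) * (real d ^ (2 * r) * (?P i / fact r)) \<in> \<int>"
      by (rule Ints_mult[OF Ints_power[OF Ints_of_nat] *])
    then show ?thesis using l
      by (simp only: mult.assoc[symmetric] power_add[symmetric] distrib_left[symmetric]) simp
  qed
  have P': "real d ^ (2 * X) * ?P i \<in> \<int>" if i: "i \<in> {1..q}" for i
  proof -
    have "(real d ^ (2 * X) * (?P i / fact r)) * fact r \<in> \<int>" by (rule Ints_mult[OF P[OF i] fact_in_Ints])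
    then show ?thesis by simp
  qed
  have Q: "?L * (fact r / ?Q i) \<in> \<int>" if i: "i \<in> {1..p}" for i
  proof (rule Lcm_mult_fact_div_pochhammer_Ints)
    show "real d * (a i + 1 + real k) \<in> \<int>" using a_shift_Ints[OF i, of "1 + k"] by (simp add: add_ac)
    show "a i + 1 + real k > 0" using a_gt[OF i] by simp
    have "real d * (a i + 1 + real k + real r) \<le> real d * (a i + 1 + real X)"
      using l by (intro mult_left_mono) auto
    then show "real d * (a i + 1 + real k + real r) \<le> real m" using m[OF i] by linarith
  qed (rule d_pos)
  have split: "{1..q} = {1..p} \<union> {p+1..q}" using pq by auto
  have "D m X * ((\<Prod>i=1..q. ?P i) / (\<Prod>i=1..p. ?Q i))
      = (\<Prod>i=1..q. real d ^ (2 * X) * ?P i) * (\<Prod>i=1..p. ?L / ?Q i)"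
    by (simp add: D_def prod.distrib prod_dividef power_mult)
  also have "(\<Prod>i=1..q. real d ^ (2 * X) * ?P i)
      = (\<Prod>i=1..p. real d ^ (2 * X) * ?P i) * (\<Prod>i=p+1..q. real d ^ (2 * X) * ?P i)"
    unfolding split by (rule prod.union_disjoint) auto
  also have "\<dots> * (\<Prod>i=1..p. ?L / ?Q i)
      = (\<Prod>i=1..p. real d ^ (2 * X) * ?P i * (?L / ?Q i)) * (\<Prod>i=p+1..q. real d ^ (2 * X) * ?P i)"
    by (simp only: prod.distrib mult_ac)
  also have "(\<Prod>i=1..p. real d ^ (2 * X) * ?P i * (?L / ?Q i))
      = (\<Prod>i=1..p. (real d ^ (2 * X) * (?P i / fact r)) * (?L * (fact r / ?Q i)))"
    by (intro prod.cong) auto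
  also have "\<dots> * (\<Prod>i=p+1..q. real d ^ (2 * X) * ?P i) \<in> \<int>"
    using pq by (intro Ints_mult Ints_prod P P' Q) auto
  finally show ?thesis unfolding c_ratio .
qed

text \<open>Besides \<open>D m X\<close>, the powers of 1/z use d^X, the linear factors of B or G
  use d^q, and the coefficients lam_j use one more d.\<close>

lemma y_Ints:
  assumes m: "\<And>i. i \<in> {1..p} \<Longrightarrow> real d * (a i + 1 + real X) \<le> real m"
    and l: "l \<le> X"
  shows "D m X * real d ^ (X + Suc q) * y l \<in> \<int>"
proof -
  have D: "D m X \<in> \<int>" unfolding D_def by (intro Ints_mult Ints_power) auto
  have dl: "real d * lam 0 \<in> \<int>" using lam_Ints[of 0] by simp
  define E where "E k = c k / (c l * B k)" for k
  have E: "D m X * E k \<in> \<int>" if "k < l" for k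
  proof -
    have "l = Suc (l - Suc k) + k" using that by simp
    then show ?thesis using c_ratio_Ints[OF m, of "l - Suc k" k] l unfolding E_def by simp
  qed
  have nz: "c l \<noteq> 0" "c k \<noteq> 0" "B k \<noteq> 0" for k :: nat
    using c_pos[of l] c_pos[of k] B_pos[of k] by auto
  have head: "D m X * real d ^ (X + Suc q) * (lam 0 / (c l * z ^ l)) \<in> \<int>"
  proof (cases "l = 0")
    case True
    then have "D m X * real d ^ (X + Suc q) * (lam 0 / (c l * z ^ l)) = D m X * real d ^ (X + q) * (real d * lam 0)"
      by simp
    then show ?thesis using D dl by (auto intro!: Ints_mult Ints_power)
  next
    case False
    \<comment> \<open>Since c_0 = 1, the reciprocal of c_l is B(0) E(0), which brings the constant
      term under \<open>c_ratio_Ints\<close> with k = 0.\<close>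
    have "lam 0 / (c l * z ^ l) = lam 0 * B 0 * E 0 * (1 / z) ^ l"
      using nz(3)[of 0] by (simp add: E_def power_divide)
    then have "D m X * real d ^ (X + Suc q) * (lam 0 / (c l * z ^ l))
        = (D m X * E 0) * (real d * lam 0) * (real d ^ q * B (real 0)) * (real d ^ X * (1 / z) ^ l)"
      by (simp add: power_add mult_ac)
    also have "\<dots> \<in> \<int>" using False l
      by (intro Ints_mult[OF Ints_mult[OF Ints_mult]] E dl B_Ints z_power_inverse_Ints) auto
    finally show ?thesis .
  qed
  have tail: "D m X * real d ^ (X + Suc q) * (c k * (G k / B k) * z ^ k / (c l * z ^ l)) \<in> \<int>"
    if k: "k < l" for k
  proof -
    have "z ^ l = z ^ k * z ^ (l - k)" using k by (simp flip: power_add)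
    then have "c k * (G k / B k) * z ^ k / (c l * z ^ l) = E k * G k * (1 / z) ^ (l - k)"
      using z_nz by (simp add: E_def power_divide mult_ac)
    then have "D m X * real d ^ (X + Suc q) * (c k * (G k / B k) * z ^ k / (c l * z ^ l))
        = (D m X * E k) * (real d ^ Suc q * G k) * (real d ^ X * (1 / z) ^ (l - k))"
      by (simp add: power_add mult_ac)
    also have "\<dots> \<in> \<int>" using k l
      by (intro Ints_mult[OF Ints_mult] E G_Ints z_power_inverse_Ints) auto
    finally show ?thesis .
  qed
  have "D m X * real d ^ (X + Suc q) * y l = D m X * real d ^ (X + Suc q) * (lam 0 / (c l * z ^ l))
      + (\<Sum>k<l. D m X * real d ^ (X + Suc q) * (c k * (G k / B k) * z ^ k / (c l * z ^ l)))"
    unfolding y_def add_divide_distrib sum_divide_distrib distrib_left sum_distrib_left ..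
  also have "\<dots> \<in> \<int>" by (intro Ints_add Ints_sum head tail) auto
  finally show ?thesis .
qed

lemma V_Ints: "real d ^ (2 * n * q) * (V n (real l) / fact n ^ q) \<in> \<int>"
proof -
  have "real d ^ (2 * n * q) * (V n (real l) / fact n ^ q)
      = (\<Prod>i=1..q. real d ^ (2 * n) * (pochhammer (b i + real (Suc l)) n / fact n))"
    by (simp add: V_pochhammer prod.distrib prod_dividef power_mult add_ac)
  also have "\<dots> \<in> \<int>"
    by (intro Ints_prod fact_dvd_pochhammer_rational d_pos b_shift_Ints)
  finally show ?thesis .
qed

text \<open>Clearing the denominators \<open>B(l + s)\<close> with \<open>s \<le> t\<close> uses up \<open>t + 1\<close> of the \<open>n\<close> factors of \<open>V\<^sub>p n\<close>;
  since \<open>p < q\<close> and \<open>degree G\<^sub>p < q\<close>, what remains has degree less than \<open>q n\<close>.\<close>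

lemma low_term_poly:
  assumes "t < n"
  obtains P where "degree P < q * n"
    "\<And>l::nat. V n l * (c (t + l) / c l * (G (real (t + l)) / B (real (t + l)))) = poly P (real l)"
proof
  define P where "P = (\<Prod>s<t. shift_poly A\<^sub>p (real s)) * shift_poly G\<^sub>p (real t)
    * (\<Prod>s\<in>{t<..<n}. shift_poly B\<^sub>p (real s))"
  have "degree P \<le> t * p + degree G\<^sub>p + (n - Suc t) * q"
  proof -
    have "degree (\<Prod>s<t. shift_poly A\<^sub>p (real s)) \<le> t * p"
      by (rule order.trans[OF degree_prod_sum_le]) (auto simp: degree_A)
    moreover have "degree (\<Prod>s\<in>{t<..<n}. shift_poly B\<^sub>p (real s)) \<le> (n - Suc t) * q"
      by (rule order.trans[OF degree_prod_sum_le]) (auto simp: degree_B)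
    ultimately show ?thesis unfolding P_def
      by (intro order.trans[OF degree_mult_le] add_mono) auto
  qed
  also have "\<dots> < t * q + q + (n - Suc t) * q"
    using degree_G pq mult_le_mono2[of p q t] by linarith
  also have "\<dots> = (t + 1 + (n - Suc t)) * q" by (simp add: algebra_simps)
  also have "t + 1 + (n - Suc t) = n" using assms by simp
  finally show "degree P < q * n" by (simp add: mult.commute)
  fix l :: nat
  have Bnz: "B (real l + real s) \<noteq> 0" for s :: nat using B_pos[of "real l + real s"] by simp
  have "{..<n} = {..<t} \<union> ({t} \<union> {t<..<n})" using assms by auto
  moreover have "prod f ({..<t} \<union> ({t} \<union> {t<..<n})) = prod f {..<t} * (f t * prod f {t<..<n})"
    for f :: "nat \<Rightarrow> real"
    by (subst prod.union_disjoint) auto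
  ultimately have "V n l = (\<Prod>s<t. B (real l + real s)) * (B (real l + real t) * (\<Prod>s\<in>{t<..<n}. B (real l + real s)))"
    unfolding V_eq by presburger
  moreover have "c (t + l) / c l = (\<Prod>s<t. A (real l + real s)) / (\<Prod>s<t. B (real l + real s))"
    using c_pos[of l] by (simp add: c_add prod_dividef)
  ultimately show "V n l * (c (t + l) / c l * (G (real (t + l)) / B (real (t + l)))) = poly P (real l)"
    using Bnz by (simp add: P_def poly_prod add.commute[of "real t"])
qed

section \<open>Smallness of the approximations\<close>

lemma b_lower_bound:
  obtains \<delta> where "\<delta> > 0" "\<delta> \<le> 1" "\<And>i. i \<in> {1..q} \<Longrightarrow> \<delta> \<le> b i + 1"
proof
  \<comment> \<open>The inserted 1 caps \<open>\<delta>\<close>, so that \<delta> (x + 1) <= b_i + 1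
    + x in \<open>A_div_B_le\<close>.\<close>
  let ?S = "insert 1 ((\<lambda>i. b i + 1) ` {1..q})"
  have "0 < x" if "x \<in> ?S" for x using that b_gt by fastforce
  then show "Min ?S > 0" by (subst Min_gr_iff) auto
  show "Min ?S \<le> 1" by (intro Min_le) auto
  show "Min ?S \<le> b i + 1" if "i \<in> {1..q}" for i using that by (intro Min_le) auto
qed

text \<open>The first p factors are compared through a_i < b_i; each of the remaining q - p >= 1
  factors of B is at least \<delta> (x + 1). The one power of x + 1 kept here produces the factorial
  decay of the tails.\<close>

lemma A_div_B_le:
  obtains K where "K > 0" "\<And>x. x \<ge> 0 \<Longrightarrow> A x / B x \<le> K / (x + 1)"
proof -
  obtain \<delta> where \<delta>: "\<delta> > 0" "\<delta> \<le> 1" "\<And>i. i \<in> {1..q} \<Longrightarrow> \<delta> \<le> b i + 1"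
    by (rule b_lower_bound) blast
  have "A x / B x \<le> (1 / \<delta> ^ (q - p)) / (x + 1)" if x: "x \<ge> 0" for x
  proof -
    have "{1..q} = {1..p} \<union> {p+1..q}" using pq by auto
    then have "B x = (\<Prod>i\<in>{1..p} \<union> {p+1..q}. b i + 1 + x)" unfolding B_eq by simp
    also have "\<dots> = (\<Prod>i=1..p. b i + 1 + x) * (\<Prod>i=p+1..q. b i + 1 + x)"
      by (rule prod.union_disjoint) auto
    finally have B: "B x = \<dots>" .
    have A: "A x \<le> (\<Prod>i=1..p. b i + 1 + x)" unfolding A_eq
    proof (intro prod_mono conjI)
      fix i assume i: "i \<in> {1..p}"
      show "0 \<le> a i + 1 + x" "a i + 1 + x \<le> b i + 1 + x" using a_gt[OF i] a_less_b[OF i] x by auto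
    qed
    have "\<delta> ^ (q - p) * (x + 1) \<le> (\<delta> * (x + 1)) ^ (q - p)"
      using x pq \<delta>(1) by (simp add: power_mult_distrib self_le_power)
    also have "\<dots> = (\<Prod>i=p+1..q. \<delta> * (x + 1))" by simp
    also have "\<dots> \<le> (\<Prod>i=p+1..q. b i + 1 + x)"
    proof (intro prod_mono conjI)
      fix i assume i: "i \<in> {p+1..q}"
      have "\<delta> * x \<le> x" using x \<delta> by (intro mult_left_le_one_le) auto
      then show "\<delta> * (x + 1) \<le> b i + 1 + x" using \<delta>(3)[of i] i by (simp add: distrib_left)
      show "0 \<le> \<delta> * (x + 1)" using x \<delta> by simp
    qed
    finally have "A x * (\<delta> ^ (q - p) * (x + 1)) \<le> B x"
      unfolding B using A A_pos[OF x] x \<delta>(1) by (intro mult_mono) auto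
    moreover have "\<delta> ^ (q - p) * (x + 1) > 0" using \<delta>(1) x by simp
    ultimately have "A x \<le> B x / (\<delta> ^ (q - p) * (x + 1))" by (simp only: pos_le_divide_eq)
    then show ?thesis using B_pos[OF x] by (simp add: divide_le_eq)
  qed
  then show thesis using \<delta>(1) by (intro that[of "1 / \<delta> ^ (q - p)"]) auto
qed

lemma G_div_B_le:
  obtains R where "R \<ge> 0" "\<And>x. x \<ge> 0 \<Longrightarrow> \<bar>G x / B x\<bar> \<le> R"
proof -
  obtain \<delta> where \<delta>: "\<delta> > 0" "\<delta> \<le> 1" "\<And>i. i \<in> {1..q} \<Longrightarrow> \<delta> \<le> b i + 1"
    by (rule b_lower_bound) blast
  define R where "R = (\<Sum>j=1..q. \<bar>lam j\<bar> / \<delta> ^ j)"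
  have "\<bar>G x / B x\<bar> \<le> R" if x: "x \<ge> 0" for x
  proof -
    have "\<bar>G x\<bar> \<le> (\<Sum>j=1..q. \<bar>lam j * (\<Prod>i=j+1..q. b i + 1 + x)\<bar>)"
      unfolding G_eq by (rule sum_abs)
    also have "\<dots> \<le> (\<Sum>j=1..q. \<bar>lam j\<bar> / \<delta> ^ j * B x)"
    proof (rule sum_mono)
      fix j assume j: "j \<in> {1..q}"
      have pos: "0 < b i + 1 + x" if "i \<in> {1..q}" for i using b_gt[OF that] x by simp
      have P: "0 \<le> (\<Prod>i=j+1..q. b i + 1 + x)" using pos by (intro prod_nonneg) (auto intro: less_imp_le)
      have "\<delta> ^ j = (\<Prod>i=1..j. \<delta>)" by simp
      also have "\<dots> \<le> (\<Prod>i=1..j. b i + 1 + x)"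
      proof (intro prod_mono conjI)
        fix i assume "i \<in> {1..j}"
        then show "\<delta> \<le> b i + 1 + x" using \<delta>(3)[of i] j x by simp
      qed (use \<delta> in simp)
      finally have "\<delta> ^ j * (\<Prod>i=j+1..q. b i + 1 + x) \<le> (\<Prod>i=1..j. b i + 1 + x) * (\<Prod>i=j+1..q. b i + 1 + x)"
        using P by (rule mult_right_mono)
      also have "\<dots> = (\<Prod>i\<in>{1..j} \<union> {j+1..q}. b i + 1 + x)"
        by (rule prod.union_disjoint[symmetric]) auto
      also have "{1..j} \<union> {j+1..q} = {1..q}" using j by auto
      finally have "(\<Prod>i=j+1..q. b i + 1 + x) \<le> B x / \<delta> ^ j"
        using \<delta>(1) by (simp add: B_eq field_simps)
      then have "\<bar>lam j\<bar> * (\<Prod>i=j+1..q. b i + 1 + x) \<le> \<bar>lam j\<bar> * (B x / \<delta> ^ j)"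
        by (rule mult_left_mono) simp
      then show "\<bar>lam j * (\<Prod>i=j+1..q. b i + 1 + x)\<bar> \<le> \<bar>lam j\<bar> / \<delta> ^ j * B x"
        using P by (simp add: abs_mult)
    qed
    also have "\<dots> = R * B x" by (simp add: R_def sum_distrib_right)
    finally show ?thesis using B_pos[OF x] by (simp add: abs_divide divide_le_eq)
  qed
  moreover have "R \<ge> 0" unfolding R_def using \<delta>(1) by (intro sum_nonneg) auto
  ultimately show thesis by (intro that)
qed

text \<open>The tail of the series from index l on, normalized as in \<open>y\<close>; under the
  relation its sum is \<open>- y l\<close> (\<open>u_sums\<close>).\<close>

definition u :: "nat \<Rightarrow> nat \<Rightarrow> real" where
  "u l t = c (t + l) / c l * (G (real (t + l)) / B (real (t + l))) * z ^ t"

text \<open>Going from t to t + 1 multiplies c_(t+l) / c_l by A/B at t + l, hence by at most K / (t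
  + 1). The bound is uniform in l, as needed when l ranges up to a multiple of n.\<close>

lemma u_bound:
  obtains R Z where "R \<ge> 0" "Z \<ge> 0" "\<And>l t. \<bar>u l t\<bar> \<le> R * (Z ^ t / fact t)"
proof -
  obtain K where K: "K > 0" "\<And>x. x \<ge> 0 \<Longrightarrow> A x / B x \<le> K / (x + 1)" by (rule A_div_B_le) blast
  obtain R where R: "R \<ge> 0" "\<And>x. x \<ge> 0 \<Longrightarrow> \<bar>G x / B x\<bar> \<le> R" by (rule G_div_B_le) blast
  have c: "c (t + l) / c l \<le> K ^ t / fact t" for t l
  proof (induction t)
    case 0
    show ?case using c_pos[of l] by simp
  next
    case (Suc t)
    let ?x = "real (t + l)"
    have "A ?x / B ?x \<le> K / (?x + 1)" by (rule K(2)) simp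
    also have "\<dots> \<le> K / (real t + 1)" using K(1) by (intro divide_left_mono) auto
    finally have AB: "A ?x / B ?x \<le> K / (real t + 1)" .
    have "c (Suc t + l) / c l = (c (t + l) / c l) * (A ?x / B ?x)" by (simp add: c_Suc)
    also have "\<dots> \<le> (K ^ t / fact t) * (K / (real t + 1))"
      using Suc AB c_pos[of l] c_pos[of "t + l"] A_pos[of ?x] B_pos[of ?x] K(1)
      by (intro mult_mono) (auto intro: less_imp_le)
    also have "\<dots> = K ^ Suc t / fact (Suc t)" by (simp add: field_simps)
    finally show ?case .
  qed
  have "\<bar>u l t\<bar> \<le> R * ((K * \<bar>z\<bar>) ^ t / fact t)" for l t
  proof -
    have "\<bar>u l t\<bar> = (c (t + l) / c l) * \<bar>G (real (t + l)) / B (real (t + l))\<bar> * \<bar>z\<bar> ^ t"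
      using c_pos[of l] c_pos[of "t + l"] by (simp add: u_def abs_mult power_abs)
    also have "\<dots> \<le> (K ^ t / fact t) * R * \<bar>z\<bar> ^ t"
      using c K(1) R by (intro mult_mono mult_right_mono) auto
    finally show ?thesis by (simp add: power_mult_distrib mult_ac)
  qed
  then show thesis using R(1) K(1) by (intro that[of R "K * \<bar>z\<bar>"]) auto
qed

lemma V_bound:
  obtains \<beta> :: nat where "\<And>n l. \<bar>V n (real l) / fact n ^ q\<bar> \<le> 2 ^ ((\<beta> + l + n) * q)"
proof -
  \<comment> \<open>The \<open>Suc\<close> keeps the natural subtraction in \<beta> + l + n - 1
    exact, so that the Pochhammer quotient becomes a binomial coefficient.\<close>
  define \<beta> where "\<beta> = Suc (\<Sum>i=1..q. nat \<lceil>b i + 1\<rceil>)"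
  have \<beta>: "b i + 1 \<le> real \<beta>" if i: "i \<in> {1..q}" for i
  proof -
    have "nat \<lceil>b i + 1\<rceil> \<le> (\<Sum>i=1..q. nat \<lceil>b i + 1\<rceil>)" using i by (intro member_le_sum) auto
    then show ?thesis unfolding \<beta>_def by linarith
  qed
  have "\<bar>V n (real l) / fact n ^ q\<bar> \<le> 2 ^ ((\<beta> + l + n) * q)" for n l
  proof -
    have poch: "0 \<le> pochhammer (b i + 1 + real l) n / fact n \<and>
        pochhammer (b i + 1 + real l) n / fact n \<le> 2 ^ (\<beta> + l + n)" if i: "i \<in> {1..q}" for i
    proof
      have pos: "b i + 1 + real l > 0" using b_gt[OF i] by simp
      then show "0 \<le> pochhammer (b i + 1 + real l) n / fact n"
        by (simp add: pochhammer_nonneg)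
      have "pochhammer (b i + 1 + real l) n \<le> pochhammer (real (\<beta> + l)) n"
        unfolding pochhammer_prod using pos \<beta>[OF i] by (intro prod_mono) auto
      then have "pochhammer (b i + 1 + real l) n / fact n \<le> pochhammer (real (\<beta> + l)) n / fact n"
        by (rule divide_right_mono) simp
      also have "\<dots> = real (\<beta> + l + n - 1) gchoose n"
        by (simp add: gbinomial_pochhammer' \<beta>_def add_ac)
      also have "\<dots> = real ((\<beta> + l + n - 1) choose n)" by (simp add: binomial_gbinomial)
      also have "\<dots> \<le> real (2 ^ (\<beta> + l + n - 1))" by (simp only: of_nat_le_iff binomial_le_pow2)
      also have "\<dots> \<le> 2 ^ (\<beta> + l + n)" by simp
      finally show "pochhammer (b i + 1 + real l) n / fact n \<le> 2 ^ (\<beta> + l + n)" .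
    qed
    have "V n (real l) / fact n ^ q = (\<Prod>i=1..q. pochhammer (b i + 1 + real l) n / fact n)"
      by (simp add: V_pochhammer prod_dividef)
    moreover have "\<dots> \<ge> 0" using poch by (intro prod_nonneg) blast
    moreover have "\<dots> \<le> (\<Prod>i=1..q. 2 ^ (\<beta> + l + n))" using poch by (intro prod_mono) blast
    ultimately show ?thesis by (simp add: power_mult)
  qed
  then show thesis by (rule that)
qed

end

text \<open>The recurrence and the estimates so far hold for any coefficients lam; the relation
  identifies partial sums with tails, and \<open>inconsistent\<close> refutes it.\<close>

locale hyp_relation = hyp_params +
  assumes relation: "(\<lambda>k. c k * (G (real k) / B (real k)) * z ^ k) sums (- lam 0)"
begin

lemma u_sums: "u l sums (- y l)"
proof -
  have "(\<lambda>t. c (t + l) * (G (real (t + l)) / B (real (t + l))) * z ^ (t + l) / (c l * z ^ l))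
      sums ((- lam 0 - (\<Sum>k<l. c k * (G k / B k) * z ^ k)) / (c l * z ^ l))"
    by (intro sums_divide sums_split_initial_segment relation)
  moreover have "c (t + l) * (G (real (t + l)) / B (real (t + l))) * z ^ (t + l) / (c l * z ^ l) = u l t" for t
    using z_nz by (simp add: u_def power_add mult_ac)
  moreover have "(- lam 0 - (\<Sum>k<l. c k * (G k / B k) * z ^ k)) / (c l * z ^ l) = - y l"
    by (simp only: y_def minus_divide_left minus_add_distrib diff_conv_add_uminus)
  ultimately show ?thesis by simp
qed

text \<open>From n! t! <= (n + t)! the factor Z^n / n! comes out of the remainder, and what is left
  sums to exp Z.\<close>

lemma y_tail_bound:
  obtains R Z where "R \<ge> 0" "Z \<ge> 0"
    "\<And>l n. \<bar>- y l - (\<Sum>t<n. u l t)\<bar> \<le> R * (Z ^ n / fact n)"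
proof -
  obtain R Z where RZ: "R \<ge> 0" "Z \<ge> 0" "\<And>l t. \<bar>u l t\<bar> \<le> R * (Z ^ t / fact t)" by (rule u_bound) blast
  have "\<bar>- y l - (\<Sum>t<n. u l t)\<bar> \<le> (R * exp Z) * (Z ^ n / fact n)" for l n
  proof -
    have s: "(\<lambda>t. u l (t + n)) sums (- y l - (\<Sum>t<n. u l t))"
      by (intro sums_split_initial_segment u_sums)
    have "(\<lambda>t. Z ^ t /\<^sub>R fact t) sums exp Z" by (rule exp_converges)
    then have g: "(\<lambda>t. R * (Z ^ n / fact n) * (Z ^ t / fact t)) sums (R * (Z ^ n / fact n) * exp Z)"
      by (intro sums_mult) (simp add: divide_inverse mult.commute)
    have le: "norm (u l (t + n)) \<le> R * (Z ^ n / fact n) * (Z ^ t / fact t)" for t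
    proof -
      have "fact n * fact t \<le> (fact (t + n) :: real)"
        using dvd_imp_le[OF fact_fact_dvd_fact[of n t]] by (metis add.commute fact_gt_zero of_nat_fact of_nat_le_iff of_nat_mult)
      then have "Z ^ (t + n) / fact (t + n) \<le> Z ^ (t + n) / (fact n * fact t)"
        using RZ(2) by (intro divide_left_mono) auto
      then have "R * (Z ^ (t + n) / fact (t + n)) \<le> R * (Z ^ (t + n) / (fact n * fact t))"
        using RZ(1) by (rule mult_left_mono)
      then show ?thesis using RZ(3)[of l "t + n"] by (simp add: power_add mult_ac)
    qed
    have "\<bar>\<Sum>t. u l (t + n)\<bar> \<le> (\<Sum>t. R * (Z ^ n / fact n) * (Z ^ t / fact t))"
      using norm_suminf_le[OF le sums_summable[OF g]] by simp
    then show ?thesis using sums_unique[OF s] sums_unique[OF g] by (simp add: mult_ac)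
  qed
  then show thesis using RZ by (intro that[of "R * exp Z" Z]) auto
qed

text \<open>Up to \<open>n!\<^sup>q\<close> and a power of \<open>z\<close> this is the value at the given relation of the Hermite--Pade approximation with denominator polynomial
  \<open>\<Sum>s. (-1) ^ s (q n choose s) V n (i + s) / c (i + s) x ^ (q n - s)\<close>. All shifts \<open>i\<close> up to a multiple of \<open>n\<close>
  can be afforded since they change sizes and denominators only by exponential factors.\<close>

definition W :: "nat \<Rightarrow> nat \<Rightarrow> real" where
  "W n i = (\<Sum>s\<le>q * n. (-1) ^ s * real (q * n choose s) * (V n (real (i + s)) / fact n ^ q * y (i + s)))"

text \<open>After exchanging the sums, each fixed t < n gives the q n-th difference of a polynomial
  from \<open>low_term_poly\<close>, which is zero.\<close>

lemma W_eq_tails: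
  "W n i = - (\<Sum>s\<le>q * n. (-1) ^ s * real (q * n choose s) *
     (V n (real (i + s)) / fact n ^ q * (- y (i + s) - (\<Sum>t<n. u (i + s) t))))"
proof -
  let ?w = "\<lambda>s. (-1) ^ s * real (q * n choose s)"
  have "(\<Sum>s\<le>q * n. ?w s * (V n (real (i + s)) / fact n ^ q * (\<Sum>t<n. u (i + s) t)))
      = (\<Sum>t<n. \<Sum>s\<le>q * n. ?w s * (V n (real (i + s)) / fact n ^ q * u (i + s) t))"
    unfolding sum_distrib_left by (rule sum.swap)
  also have "\<dots> = 0"
  proof (rule sum.neutral, rule ballI)
    fix t assume "t \<in> {..<n}"
    then obtain P where P: "degree P < q * n"
      "\<And>l::nat. V n l * (c (t + l) / c l * (G (real (t + l)) / B (real (t + l)))) = poly P (real l)"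
      using low_term_poly[of t n] by auto
    have eq: "V n (real l) / fact n ^ q * u l t = (z ^ t / fact n ^ q) * poly P (real l)" for l
      unfolding P(2)[symmetric] u_def by simp
    have "(\<Sum>s\<le>q * n. ?w s * (V n (real (i + s)) / fact n ^ q * u (i + s) t))
        = (z ^ t / fact n ^ q) * (\<Sum>s\<le>q * n. ?w s * poly P (real i + real s))"
      unfolding eq sum_distrib_left by (simp add: mult_ac)
    then show "(\<Sum>s\<le>q * n. ?w s * (V n (real (i + s)) / fact n ^ q * u (i + s) t)) = 0"
      using alternating_binomial_sum_poly_eq_0[OF P(1)] by simp
  qed
  finally show ?thesis
    by (simp add: W_def right_diff_distrib sum_subtractf sum_negf)
qed

lemma W_bound:
  obtains R Z :: real and \<beta> :: nat where "R \<ge> 0" "Z \<ge> 0"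
    "\<And>n i X. i + q * n \<le> X \<Longrightarrow> \<bar>W n i\<bar> \<le> 2 ^ (q * n) * 2 ^ ((\<beta> + X + n) * q) * (R * (Z ^ n / fact n))"
proof -
  obtain R Z where RZ: "R \<ge> 0" "Z \<ge> 0"
    "\<And>l n. \<bar>- y l - (\<Sum>t<n. u l t)\<bar> \<le> R * (Z ^ n / fact n)" by (rule y_tail_bound) blast
  obtain \<beta> :: nat where \<beta>: "\<And>n l. \<bar>V n (real l) / fact n ^ q\<bar> \<le> 2 ^ ((\<beta> + l + n) * q)"
    by (rule V_bound) blast
  have "\<bar>W n i\<bar> \<le> 2 ^ (q * n) * 2 ^ ((\<beta> + X + n) * q) * (R * (Z ^ n / fact n))"
    if X: "i + q * n \<le> X" for n i X
  proof -
    let ?T = "\<lambda>s. - y (i + s) - (\<Sum>t<n. u (i + s) t)"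
    have "\<bar>W n i\<bar> \<le> (\<Sum>s\<le>q * n. \<bar>(-1) ^ s * real (q * n choose s) * (V n (real (i + s)) / fact n ^ q * ?T s)\<bar>)"
      unfolding W_eq_tails abs_minus_cancel by (rule sum_abs)
    also have "\<dots> \<le> (\<Sum>s\<le>q * n. real (q * n choose s) * (2 ^ ((\<beta> + X + n) * q) * (R * (Z ^ n / fact n))))"
    proof (rule sum_mono)
      fix s assume s: "s \<in> {..q * n}"
      have "\<bar>V n (real (i + s)) / fact n ^ q\<bar> \<le> 2 ^ ((\<beta> + (i + s) + n) * q)" by (rule \<beta>)
      also have "\<dots> \<le> 2 ^ ((\<beta> + X + n) * q)"
        using s X by (intro power_increasing mult_le_mono1) auto
      finally have "\<bar>V n (real (i + s)) / fact n ^ q\<bar> * \<bar>?T s\<bar>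
          \<le> 2 ^ ((\<beta> + X + n) * q) * (R * (Z ^ n / fact n))"
        by (intro mult_mono RZ(3)) auto
      then have "real (q * n choose s) * (\<bar>V n (real (i + s)) / fact n ^ q\<bar> * \<bar>?T s\<bar>)
          \<le> real (q * n choose s) * (2 ^ ((\<beta> + X + n) * q) * (R * (Z ^ n / fact n)))"
        by (rule mult_left_mono) simp
      then show "\<bar>(-1) ^ s * real (q * n choose s) * (V n (real (i + s)) / fact n ^ q * ?T s)\<bar>
          \<le> real (q * n choose s) * (2 ^ ((\<beta> + X + n) * q) * (R * (Z ^ n / fact n)))"
        by (simp add: abs_mult power_abs)
    qed
    also have "\<dots> = real (\<Sum>s\<le>q * n. q * n choose s) * (2 ^ ((\<beta> + X + n) * q) * (R * (Z ^ n / fact n)))"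
      by (simp only: sum_distrib_right of_nat_sum)
    finally show ?thesis by (simp add: choose_row_sum mult_ac)
  qed
  then show thesis using RZ by (intro that)
qed

lemma W_Ints:
  assumes m: "\<And>h. h \<in> {1..p} \<Longrightarrow> real d * (a h + 1 + real X) \<le> real m" and X: "i + q * n \<le> X"
  shows "(real d ^ (2 * n * q) * (D m X * real d ^ (X + Suc q))) * W n i \<in> \<int>"
proof -
  let ?w = "\<lambda>s. (-1) ^ s * real (q * n choose s)"
  have "(real d ^ (2 * n * q) * (D m X * real d ^ (X + Suc q))) * W n i
      = (\<Sum>s\<le>q * n. ?w s * ((real d ^ (2 * n * q) * (V n (real (i + s)) / fact n ^ q))
          * (D m X * real d ^ (X + Suc q) * y (i + s))))"
    unfolding W_def sum_distrib_left by (intro sum.cong) (auto simp: mult_ac)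
  also have "\<dots> \<in> \<int>"
  proof (rule Ints_sum)
    fix s assume s: "s \<in> {..q * n}"
    have "?w s \<in> \<int>" by (intro Ints_mult Ints_power) auto
    moreover have "D m X * real d ^ (X + Suc q) * y (i + s) \<in> \<int>"
      using s X by (intro y_Ints m) auto
    ultimately show "?w s * ((real d ^ (2 * n * q) * (V n (real (i + s)) / fact n ^ q))
          * (D m X * real d ^ (X + Suc q) * y (i + s))) \<in> \<int>"
      by (intro Ints_mult[OF _ Ints_mult] V_Ints)
  qed
  finally show ?thesis .
qed

text \<open>A nonzero integer cannot have absolute value below 1. The range 3 q n is linear in n, so
  denominators stay exponential, and it is long enough for the degree count in
  \<open>inconsistent\<close>.\<close>

lemma ex_W_eq_0: "\<exists>n>0. \<forall>i. i + q * n \<le> 3 * q * n \<longrightarrow> W n i = 0"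
proof -
  obtain R Z :: real and \<beta> :: nat where RZ: "R \<ge> 0" "Z \<ge> 0" and
    W: "\<And>n i X. i + q * n \<le> X \<Longrightarrow> \<bar>W n i\<bar> \<le> 2 ^ (q * n) * 2 ^ ((\<beta> + X + n) * q) * (R * (Z ^ n / fact n))"
    by (rule W_bound) blast
  define \<alpha> where "\<alpha> = (\<Sum>h=1..p. nat \<lceil>a h + 1\<rceil>)"
  have \<alpha>: "a h + 1 \<le> real \<alpha>" if h: "h \<in> {1..p}" for h
  proof -
    have "nat \<lceil>a h + 1\<rceil> \<le> \<alpha>" unfolding \<alpha>_def using h by (intro member_le_sum) auto
    then show ?thesis by linarith
  qed
  define X where "X n = 3 * q * n" for n
  define m where "m n = d * (\<alpha> + X n)" for n
  have m: "real d * (a h + 1 + real (X n)) \<le> real (m n)" if "h \<in> {1..p}" for h n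
    unfolding m_def of_nat_mult of_nat_add using \<alpha>[OF that] by (intro mult_left_mono) auto
  define \<Delta> where "\<Delta> n = real d ^ (2 * n * q) * (D (m n) (X n) * real d ^ (X n + Suc q))" for n
  \<comment> \<open>With X = 3 q n, \<open>C1\<close> collects the part of the denominator bound
    whose exponent is proportional to n and \<open>C2\<close> the rest; \<open>C3\<close> does the
    same for the powers of 2 in the size bound.\<close>
  define C1 where "C1 = real d ^ (2 * q + 6 * q * q + 3 * q) * 16 ^ (3 * q * d * p)"
  define C2 where "C2 = real d ^ Suc q * 16 ^ (d * \<alpha> * p)"
  define C3 where "C3 = (2::real) ^ (q + 3 * q * q + q)"
  have \<Delta>_pos: "\<Delta> n > 0" for n
    unfolding \<Delta>_def D_def using d_pos Lcm_pos[of "m n"] by simp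
  have \<Delta>: "\<Delta> n \<le> C2 * C1 ^ n" for n
  proof -
    have "real (Lcm {1..m n}) \<le> real (16 ^ m n)"
      using Lcm_atLeastAtMost_le[of "m n"] by (simp only: of_nat_le_iff)
    then have "real (Lcm {1..m n}) ^ p \<le> (16 ^ m n) ^ p" by (intro power_mono) auto
    then have "\<Delta> n \<le> real d ^ (2 * n * q) * (real d ^ (2 * X n * q) * (16 ^ m n) ^ p * real d ^ (X n + Suc q))"
      unfolding \<Delta>_def D_def by (intro mult_left_mono mult_right_mono) auto
    also have "\<dots> = real d ^ (2 * n * q + 2 * X n * q + (X n + Suc q)) * 16 ^ (m n * p)"
      unfolding power_add power_mult[of "16::real" "m n" p] by (simp only: mult.assoc mult.left_commute mult.commute[of _ "_ ^ p"])
    also have "2 * n * q + 2 * X n * q + (X n + Suc q) = Suc q + (2 * q + 6 * q * q + 3 * q) * n"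
      by (simp add: X_def algebra_simps)
    also have "m n * p = d * \<alpha> * p + (3 * q * d * p) * n"
      by (simp add: m_def X_def algebra_simps)
    also have "real d ^ (Suc q + (2 * q + 6 * q * q + 3 * q) * n) * 16 ^ (d * \<alpha> * p + (3 * q * d * p) * n)
        = C2 * C1 ^ n"
      unfolding C1_def C2_def power_add power_mult power_mult_distrib by (simp only: mult_ac)
    finally show ?thesis .
  qed
  define K where "K = C2 * 2 ^ (\<beta> * q) * R"
  define Y where "Y = C1 * C3 * Z"
  have bound: "\<bar>\<Delta> n * W n i\<bar> \<le> K * (inverse (fact n) * Y ^ n)" if "i + q * n \<le> X n" for n i
  proof -
    have "\<bar>\<Delta> n * W n i\<bar> \<le> (C2 * C1 ^ n) * (2 ^ (q * n) * 2 ^ ((\<beta> + X n + n) * q) * (R * (Z ^ n / fact n)))"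
      unfolding abs_mult using \<Delta>[of n] \<Delta>_pos[of n] by (intro mult_mono W that) auto
    also have "2 ^ (q * n) * 2 ^ ((\<beta> + X n + n) * q) = (2::real) ^ (q * n + (\<beta> + X n + n) * q)"
      by (simp only: power_add)
    also have "q * n + (\<beta> + X n + n) * q = \<beta> * q + (q + 3 * q * q + q) * n"
      by (simp add: X_def algebra_simps)
    also have "(2::real) ^ (\<beta> * q + (q + 3 * q * q + q) * n) = 2 ^ (\<beta> * q) * C3 ^ n"
      unfolding C3_def power_add power_mult ..
    finally show ?thesis by (simp add: K_def Y_def power_mult_distrib divide_inverse mult_ac)
  qed
  have "(\<lambda>n. K * (inverse (fact n) * Y ^ n)) \<longlonglongrightarrow> K * 0"
    by (intro tendsto_mult_left summable_LIMSEQ_zero summable_exp)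
  then have "eventually (\<lambda>n. K * (inverse (fact n) * Y ^ n) < 1) sequentially"
    by (intro order_tendstoD) auto
  then have "eventually (\<lambda>n. K * (inverse (fact n) * Y ^ n) < 1 \<and> n > 0) sequentially"
    using eventually_gt_at_top[of 0] by (rule eventually_conj)
  then obtain n where n: "K * (inverse (fact n) * Y ^ n) < 1" "n > 0"
    using eventually_happens by fastforce
  have "W n i = 0" if i: "i + q * n \<le> 3 * q * n" for i
  proof -
    have "\<Delta> n * W n i \<in> \<int>" unfolding \<Delta>_def using i by (intro W_Ints m) (auto simp: X_def)
    moreover have "\<bar>\<Delta> n * W n i\<bar> < 1" using bound[of i n] i n(1) by (simp add: X_def)
    ultimately have "\<Delta> n * W n i = 0" by (metis Ints_nonzero_abs_less1)
    then show ?thesis using \<Delta>_pos[of n] by simp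
  qed
  with n(2) show ?thesis by blast
qed

lemma inconsistent: False
proof -
  obtain n where n: "n > 0" "\<And>i. i + q * n \<le> 3 * q * n \<Longrightarrow> W n i = 0" using ex_W_eq_0 by blast
  have qn: "q * n > 0" using n pq by simp
  have "(\<Sum>s\<le>q * n. (-1) ^ s * real (q * n choose s) * (V n (real (i + s)) * y (i + s))) = 0"
    if "i + q * n \<le> 3 * q * n" for i
  proof -
    have "(\<Sum>s\<le>q * n. (-1) ^ s * real (q * n choose s) * (V n (real (i + s)) * y (i + s))) = fact n ^ q * W n i"
      unfolding W_def sum_distrib_left by (intro sum.cong) auto
    then show ?thesis using n(2)[OF that] by simp
  qed
  then obtain P where P: "degree P < q * n" "\<And>l. l \<le> 3 * q * n \<Longrightarrow> poly P (real l) = V n (real l) * y l"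
    using ex_poly_of_alternating_binomial_sums[OF qn, of "3 * q * n" "\<lambda>l. V n (real l) * y l"] by blast
  have "smult z (A\<^sub>p * B\<^sub>p * shift_poly P 1) = shift_poly B\<^sub>p (real n) * (B\<^sub>p * P + G\<^sub>p * V\<^sub>p n)"
  proof (rule poly_eqI_degree)
    show "poly (smult z (A\<^sub>p * B\<^sub>p * shift_poly P 1)) x
        = poly (shift_poly B\<^sub>p (real n) * (B\<^sub>p * P + G\<^sub>p * V\<^sub>p n)) x"
      if x: "x \<in> real ` {..<3 * q * n}" for x
    proof -
      \<comment> \<open>Strict inequality, because the value of \<open>P\<close> at l + 1 is used
        too.\<close>
      obtain l where l: "x = real l" "l < 3 * q * n" using x by auto
      \<comment> \<open>Shifting V_n by one trades the factor B(l) for B(l + n); multiplying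
        \<open>y_rec\<close> by either side clears its denominators.\<close>
      have V: "B l * V n (real (Suc l)) = B (real l + real n) * V n (real l)"
      proof -
        have "B l * V n (real (Suc l)) = (\<Prod>s<Suc n. B (real l + real s))"
          unfolding V_eq prod.lessThan_Suc_shift by (simp add: add_ac)
        then show ?thesis by (simp add: V_eq)
      qed
      have "poly (smult z (A\<^sub>p * B\<^sub>p * shift_poly P 1)) x
          = z * A l * B l * (V n (real (Suc l)) * y (Suc l))"
        using P(2)[of "Suc l"] l by (simp add: add.commute)
      also have "\<dots> = (z * A l * y (Suc l)) * (B l * V n (real (Suc l)))" by (simp only: mult_ac)
      also have "\<dots> = B (real l + real n) * (B l * (V n (real l) * y l) + G l * V n (real l))"
        unfolding V y_rec by (simp add: algebra_simps)
      finally show ?thesis using P(2)[of l] l by simp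
    qed
    have card: "card (real ` {..<3 * q * n}) = 3 * q * n" by (simp add: card_image)
    \<comment> \<open>Both sides have degree less than 2 q + q n, so agreement at 3 q n points makes
      them equal.\<close>
    have big: "2 * q + q * n \<le> 3 * q * n" using n(1) by (cases n) auto
    have "degree (smult z (A\<^sub>p * B\<^sub>p * shift_poly P 1)) \<le> p + q + degree P"
      by (rule order.trans[OF degree_smult_le])
         (metis degree_A degree_B degree_mult_le degree_shift_poly add_le_mono order.trans order_refl)
    then show "degree (smult z (A\<^sub>p * B\<^sub>p * shift_poly P 1)) < card (real ` {..<3 * q * n})"
      using P(1) pq big unfolding card by linarith
    have "degree (B\<^sub>p * P) < q + q * n"
      using P(1) degree_mult_le[of B\<^sub>p P] degree_B by linarith
    moreover have "degree (G\<^sub>p * V\<^sub>p n) < q + q * n"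
      using degree_G degree_mult_le[of G\<^sub>p "V\<^sub>p n"] degree_V[of n] by linarith
    ultimately have "degree (B\<^sub>p * P + G\<^sub>p * V\<^sub>p n) < q + q * n" by (rule degree_add_less)
    moreover have "degree (shift_poly B\<^sub>p (real n) * (B\<^sub>p * P + G\<^sub>p * V\<^sub>p n))
        \<le> q + degree (B\<^sub>p * P + G\<^sub>p * V\<^sub>p n)"
      using degree_mult_le[of "shift_poly B\<^sub>p (real n)" "B\<^sub>p * P + G\<^sub>p * V\<^sub>p n"] degree_B by simp
    ultimately show "degree (shift_poly B\<^sub>p (real n) * (B\<^sub>p * P + G\<^sub>p * V\<^sub>p n)) < card (real ` {..<3 * q * n})"
      using big unfolding card by linarith
  qed
  then show False using no_rational_solution by blast
qed

end

section \<open>Linear independence\<close>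

lemma (in hyp_params) G_div_B:
  assumes "x \<ge> 0"
  shows "G x / B x = (\<Sum>j=1..q. lam j / (\<Prod>i=1..j. b i + 1 + x))"
  unfolding G_eq sum_divide_distrib
proof (rule sum.cong)
  fix j assume j: "j \<in> {1..q}"
  have nz: "b i + 1 + x \<noteq> 0" if "i \<in> {1..q}" for i using b_gt[OF that] assms by simp
  have "{1..q} = {1..j} \<union> {j+1..q}" using j by auto
  then have "B x = (\<Prod>i\<in>{1..j} \<union> {j+1..q}. b i + 1 + x)" unfolding B_eq by simp
  also have "\<dots> = (\<Prod>i=1..j. b i + 1 + x) * (\<Prod>i=j+1..q. b i + 1 + x)"
    by (rule prod.union_disjoint) auto
  finally have "B x = \<dots>" .
  moreover have "(\<Prod>i=j+1..q. b i + 1 + x) \<noteq> 0" using nz by auto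
  ultimately show "lam j * (\<Prod>i=j+1..q. b i + 1 + x) / B x = lam j / (\<Prod>i=1..j. b i + 1 + x)"
    by simp
qed simp

lemma finite_common_denominator:
  fixes S :: "rat set"
  assumes "finite S"
  obtains d :: nat where "d > 0" "\<And>x. x \<in> S \<Longrightarrow> real d * real_of_rat x \<in> \<int>"
proof -
  have "\<exists>d::nat>0. \<forall>x\<in>S. real d * real_of_rat x \<in> \<int>"
    using assms
  proof (induction S)
    case (insert x S)
    then obtain d :: nat where d: "d > 0" "\<And>y. y \<in> S \<Longrightarrow> real d * real_of_rat y \<in> \<int>" by blast
    obtain n m where x: "x = Fract n m" "m > 0" by (cases x) auto
    have "real (nat m) * real_of_rat x = real_of_int n"
      using x by (simp add: of_rat_rat)
    then have "real (d * nat m) * real_of_rat x = real d * real_of_int n"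
      by (simp only: of_nat_mult mult.assoc)
    then have "real (d * nat m) * real_of_rat x \<in> \<int>" by (simp only: Ints_mult Ints_of_nat Ints_of_int)
    moreover have "real (d * nat m) * real_of_rat y \<in> \<int>" if "y \<in> S" for y
    proof -
      have "real (nat m) * (real d * real_of_rat y) \<in> \<int>" by (rule Ints_mult[OF Ints_of_nat d(2)[OF that]])
      then show ?thesis by (simp only: of_nat_mult mult_ac)
    qed
    ultimately show ?case using d(1) x(2) by (intro exI[of _ "d * nat m"]) auto
  qed auto
  then show thesis using that by blast
qed

theorem theorem5p9:
  fixes p q :: nat and a b :: "nat \<Rightarrow> rat" and z :: rat
  assumes "p < q"
    and "\<forall>i\<in>{1..p}. a i > -1"
    and "\<forall>i\<in>{1..q}. b i > -1"
    and "\<forall>i\<in>{1..p}. a i < b i"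
    and "z \<noteq> 0"
    and "\<forall>i\<in>{1..p}. \<forall>j\<in>{1..q}. i \<noteq> j \<longrightarrow> a i - b j \<notin> \<nat>"
    and "\<forall>i\<in>{1..q}. \<forall>j\<in>{1..q}. i \<noteq> j \<longrightarrow> b i - b j \<notin> \<nat>"
  shows "rat_lin_indep_family {0..q} (\<lambda>j. if j = 0 then 1 else hyp_const p q a b z j) \<and>
    (\<forall>j\<in>{1..q}. hyp_const p q a b z j \<notin> \<rat>)"
proof -
  let ?v = "\<lambda>j. if j = 0 then 1 else hyp_const p q a b z j"
  have zero: "\<forall>j\<in>{0..q}. r j = 0" if rel: "(\<Sum>j\<in>{0..q}. of_rat (r j) * ?v j) = 0" for r :: "nat \<Rightarrow> rat"
  proof (rule ccontr)
    assume nz: "\<not> (\<forall>j\<in>{0..q}. r j = 0)"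
    have "(\<Sum>j\<in>{0..q}. of_rat (r j) * ?v j)
        = of_rat (r 0) + (\<Sum>j=1..q. of_rat (r j) * hyp_const p q a b z j)"
      by (subst sum.atLeast_Suc_atMost) auto
    then have rel': "(\<Sum>j=1..q. of_rat (r j) * hyp_const p q a b z j) = - of_rat (r 0)"
      using rel by simp
    \<comment> \<open>A relation involving only the constant 1 would read r_0 = 0.\<close>
    have nz': "\<exists>j\<in>{1..q}. r j \<noteq> 0"
    proof (rule ccontr)
      assume "\<not> (\<exists>j\<in>{1..q}. r j \<noteq> 0)"
      then have all0: "r j = 0" if "j \<in> {1..q}" for j using that by blast
      then have "r 0 = 0" using rel' by simp
      then have "r j = 0" if "j \<in> {0..q}" for j using that all0[of j] by (cases "j = 0") auto
      then show False using nz by blast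
    qed
    obtain d :: nat where d: "d > 0"
      "\<And>x. x \<in> insert (1 / z) (a ` {1..p} \<union> b ` {1..q} \<union> r ` {0..q}) \<Longrightarrow> real d * real_of_rat x \<in> \<int>"
      by (rule finite_common_denominator[of "insert (1 / z) (a ` {1..p} \<union> b ` {1..q} \<union> r ` {0..q})"]) auto
    have Nats: "real_of_rat x - real_of_rat y \<notin> \<nat>" if "x - y \<notin> \<nat>" for x y
    proof
      assume "real_of_rat x - real_of_rat y \<in> \<nat>"
      then obtain n where "real_of_rat (x - y) = real_of_rat (of_nat n)"
        by (auto elim!: Nats_cases simp: of_rat_diff)
      then have "x - y = of_nat n" by (simp only: of_rat_eq_iff)
      then show False using that by simp
    qed
    have gt: "real_of_rat x > -1 \<longleftrightarrow> x > -1" for x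
      using of_rat_less[of "-1" x, where 'a=real] by simp
    interpret hyp_params p q d "\<lambda>i. of_rat (a i)" "\<lambda>i. of_rat (b i)" "of_rat z" "\<lambda>j. of_rat (r j)"
    proof
      show "real d * (1 / real_of_rat z) \<in> \<int>" using d(2)[of "1 / z"] by (simp add: of_rat_divide)
      show "real_of_rat (a h) - real_of_rat (b i) \<notin> \<nat>" if "h \<in> {1..p}" "i \<in> {1..q}" for h i
      proof (rule Nats, cases "h = i")
        case True
        then have "a h - b i < 0" using assms(4) that by auto
        then show "a h - b i \<notin> \<nat>" by (auto elim!: Nats_cases)
      qed (use assms(6) that in blast)
      show "real_of_rat (b h) - real_of_rat (b i) \<notin> \<nat>" if "h \<in> {1..q}" "i \<in> {1..q}" "h \<noteq> i" for h i
        using assms(7) that by (intro Nats) blast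
      show "\<exists>j\<in>{1..q}. real_of_rat (r j) \<noteq> 0" using nz' by simp
    qed (use assms d in \<open>auto simp: gt of_rat_less\<close>)
    have hyp_term: "real_of_rat (hyp_term p q a b z j k)
        = c k / (\<Prod>i=1..j. of_rat (b i) + 1 + real k) * of_rat z ^ k" for j k
    proof -
      have poch: "real_of_rat (pochhammer (1 + x) k) = pochhammer (1 + real_of_rat x) k" for x
        by (simp add: pochhammer_prod of_rat_prod of_rat_add)
      show ?thesis
        by (simp add: hyp_term_def vec_pochhammer_def c_pochhammer of_rat_mult of_rat_divide
            of_rat_prod of_rat_power of_rat_add poch add_ac)
    qed
    have "(\<lambda>k. \<Sum>j=1..q. of_rat (r j) * real_of_rat (hyp_term p q a b z j k)) sums
        (\<Sum>j=1..q. of_rat (r j) * hyp_const p q a b z j)"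
    proof (rule sums_sum)
      fix j assume "j \<in> {1..q}"
      then have "summable (\<lambda>k. real_of_rat (hyp_term p q a b z j k))"
        using assms by (intro summable_hyp_term) auto
      then show "(\<lambda>k. of_rat (r j) * real_of_rat (hyp_term p q a b z j k)) sums
          (of_rat (r j) * hyp_const p q a b z j)"
        unfolding hyp_const_def by (intro sums_mult summable_sums)
    qed
    moreover have "(\<Sum>j=1..q. of_rat (r j) * real_of_rat (hyp_term p q a b z j k))
        = c k * (G (real k) / B (real k)) * of_rat z ^ k" for k
      by (simp add: G_div_B hyp_term sum_distrib_left sum_distrib_right mult_ac)
    ultimately interpret hyp_relation p q d "\<lambda>i. of_rat (a i)" "\<lambda>i. of_rat (b i)" "of_rat z" "\<lambda>j. of_rat (r j)"
      by unfold_locales (simp only: rel')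
    show False by (rule inconsistent)
  qed
  have "hyp_const p q a b z j \<notin> \<rat>" if j: "j \<in> {1..q}" for j
  proof
    assume "hyp_const p q a b z j \<in> \<rat>"
    then obtain x where x: "hyp_const p q a b z j = of_rat x" by (auto elim: Rats_cases)
    \<comment> \<open>A rational value x of the j-th constant is itself a nontrivial relation
      between that constant and 1.\<close>
    define r where "r i = (if i = 0 then - x else if i = j then 1 else 0)" for i
    have "(\<Sum>i\<in>{0..q}. of_rat (r i) * ?v i) = (\<Sum>i\<in>{0, j}. of_rat (r i) * ?v i)"
      using j by (intro sum.mono_neutral_right) (auto simp: r_def)
    also have "\<dots> = 0" using j x by (simp add: r_def of_rat_minus)
    finally have "r j = 0" using zero[of r] j by auto
    then show False using j by (simp add: r_def)
  qed
  moreover have "rat_lin_indep_family {0..q} ?v"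
    using zero by (simp add: rat_lin_indep_family_iff)
  ultimately show ?thesis by blast
qed

end
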